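(* Let $k\in\{0,1,2,\dots\}$, let $\rho\in\mathbb{C}$ with $|\rho|<1$, and let $a,b,c\in\mathbb{C}$ be such that $\Re a>0$, $\Re b>0$, $\Re c>0$ and $\Im a=\Im b=\Im c$. Then $$ \int_{-\infty}^\infty (1-\rho)^{1-2\Re a-2\Re b}\ {}_3F_2\!\left(\begin{matrix}\Re a+\Re b-\tfrac12,\ \Re a+\Re b,\ a+ix\\ 2\Re a,\ a+\overline{b}\end{matrix};-\frac{4\rho}{(1-\rho)^2}\right)|\Gamma(a+ix)\Gamma(c+ix)|^2\,p_k(x;a,c,\overline{a},\overline{c})\,dx $$ $$ =\frac{2\pi(-i\rho)^k\,\Gamma(2\Re a)\,\Gamma(2\Re c)\,[\Gamma(a+\overline{c})]^2\,(2\Re a+2\Re b-1)_k\,(k+2\Re a+2\Re b-1)_k\,(a+\overline{c})_k\,(2\Re c)_k}{4^k\,k!\,(2k+2\Re a+2\Re c-1)\,\Gamma(2\Re a+2\Re c-1)\,(\Re a+\Re c-\tfrac12)_k\,(\Re a+\Re b)_k} $$ $$ \times\ {}_2F_1\!\left(\begin{matrix}\Re a+\Re b+k-\tfrac12,\ \Re b-\Re c\\ \Re a+\Re c+k+\tfrac12\end{matrix};\rho^2\right). $$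
   Context: The Pochhammer symbol is $(z)_n=\prod_{i=1}^n(z+i-1)$ (so $(z)_0=1$). The generalized hypergeometric function is ${}_pF_q(a_1,\dots,a_p;b_1,\dots,b_q;z)=\sum_{n\ge0}\frac{(a_1)_n\cdots(a_p)_n}{(b_1)_n\cdots(b_q)_n}\frac{z^n}{n!}$; for $p=q+1$ it is continued analytically from $|z|<1$ to $\mathbb{C}\setminus[1,\infty)$. The map $\rho\mapsto-4\rho/(1-\rho)^2$ sends the unit disk bijectively onto $\mathbb{C}\setminus[1,\infty)$. Powers of $1-\rho$ are taken with the principal branch. The continuous Hahn polynomials with two pairs of conjugate parameters are, for $a,b\in\mathbb{C}$ with positive real parts, $$p_n(x;a,b,\overline{a},\overline{b})=i^n\frac{(2\Re a)_n(a+\overline{b})_n}{n!}\ {}_3F_2\!\left(\begin{matrix}-n,\ n+2\Re a+2\Re b-1,\ a+ix\\ 2\Re a,\ a+\overline{b}\end{matrix};1\right).$$ Convention for a degenerate parameter: if $2\Re a+2\Re c=1$, the expression $(2k+T)\,\Gamma(T)\,(T/2)_k$ with $T=2\Re a+2\Re c-1$ in the denominator is understood as its limit as $T\to0$. *)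

theory Defs
  imports "HOL-Analysis.Analysis"
begin

definition hypergeo_series :: "complex list \<Rightarrow> complex list \<Rightarrow> complex \<Rightarrow> complex" where
  "hypergeo_series as bs z =
     (\<Sum>n. (\<Prod>a\<leftarrow>as. pochhammer a n) / (\<Prod>b\<leftarrow>bs. pochhammer b n) * (z ^ n / fact n))"

text \<open>
  For \<open>p = q + 1\<close>, the analytic continuation of the series from the open unit disc to the
  complex plane cut along \<open>[1, \<infinity>)\<close>. The cut plane is connected, so two functions that satisfy
  the condition under the choice operator agree on it; values on the cut itself are meaningless.
\<close>

definition hypergeo_cont :: "complex list \<Rightarrow> complex list \<Rightarrow> complex \<Rightarrow> complex" where
  "hypergeo_cont as bs =
     (SOME f. f holomorphic_on (- complex_of_real ` {1..}) \<and>
              (\<forall>z. norm z < 1 \<longrightarrow> f z = hypergeo_series as bs z))"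

text \<open>
  The polynomial \<open>p\<^sub>n(x; a, b, cnj a, cnj b)\<close>. The hypergeometric series terminates because of
  the parameter \<open>-n\<close>, which is why its value at \<open>1\<close> makes sense.
\<close>

definition continuous_Hahn :: "nat \<Rightarrow> complex \<Rightarrow> complex \<Rightarrow> complex \<Rightarrow> complex" where
  "continuous_Hahn n a b x =
     \<i> ^ n * pochhammer (of_real (2 * Re a)) n * pochhammer (a + cnj b) n / fact n *
     hypergeo_series
       [- of_nat n, of_nat n + of_real (2 * Re a + 2 * Re b - 1), a + \<i> * x]
       [of_real (2 * Re a), a + cnj b] 1"

text \<open>
  The expression \<open>(2k + T) \<Gamma>(T) (T/2)\<^sub>k\<close>, replaced by its limit at the pole \<open>T = 0\<close> of the
  Gamma function (where the library assigns the Gamma function the value 0).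
\<close>

definition Hahn_denom :: "nat \<Rightarrow> real \<Rightarrow> real" where
  "Hahn_denom k T =
     (let D = (\<lambda>t. (2 * real k + t) * Gamma t * pochhammer (t / 2) k)
      in if T = 0 then Lim (at 0) D else D T)"

end

theory Submission
  imports Defs "HOL-Probability.Probability" "HOL-Complex_Analysis.Complex_Analysis"
begin

text \<open>
  Write \<open>A, B, C\<close> for the real parts and translate \<open>x\<close> so that the imaginary parts vanish. With
  \<open>\<sigma>(u) = 1/(1 + e\<^sup>-\<^sup>u)\<close>, Euler's integral shows that \<open>|\<Gamma>(A + ix)|\<^sup>2 \<^sub>2F\<^sub>1(\<alpha>, A + ix; 2A; z)\<close> is, up to a
  constant, the Fourier transform of \<open>(\<sigma>(1 - \<sigma>))\<^sup>A (1 - z\<sigma>)\<^sup>-\<^sup>\<alpha>\<close>, where \<open>\<alpha> = A + B - 1/2\<close>, and, after a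
  terminating \<open>\<^sub>3F\<^sub>2\<close> transformation, \<open>|\<Gamma>(C + ix)|\<^sup>2 p\<^sub>k\<close> is the Fourier transform of \<open>(\<sigma>(1 - \<sigma>))\<^sup>C\<close>
  times a Gegenbauer polynomial in \<open>\<sigma>\<close>. Parseval's identity turns the integral into
  \<open>\<integral> (t(1 - t))\<^sup>A\<^sup>+\<^sup>C\<^sup>-\<^sup>1 G\<^sub>k(t) (1 - zt)\<^sup>-\<^sup>\<alpha> dt\<close> over the unit interval; \<open>k\<close> integrations by parts remove
  the polynomial, and what is left is a \<open>\<^sub>2F\<^sub>1(a, b; 2b; z)\<close>, to which the quadratic transformation for
  \<open>z = -4\<rho>/(1 - \<rho>)\<^sup>2\<close> applies.
\<close>

section \<open>Terminating hypergeometric sums\<close>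

text \<open>The substitution t = \<open>logistic u\<close> gives t/(1 - t) = e^u, so the factor
  t^(ix) (1 - t)^(-ix) of an Euler integral becomes the character e^(ixu) and x survives only as a
  Fourier variable. Since Im a = Im b, the lower parameter a + cnj b equals the upper parameter Re a
  + Re b, and the 3F2 of the integrand collapses to a 2F1. The Hahn polynomial is given through (a +
  ix)_j / (2A)_j, which fits the weight |Gamma(a + ix)|^2; but that weight is spent on the 2F1, so
  the polynomial has to be rewritten through (C - ix)_j / (2C)_j, the ratios that the other weight
  produces. Its parameter A + C is also the exponent of the product of the two kernels. The
  Gegenbauer polynomial thus meets its own weight, and this is why integration by parts removes it.
  Finally 1 - 2A - 2B = -2\<alpha>, and each of the k factors z lowers this exponent by 2, as the
  quadratic transformation requires for \<alpha> + k. Integrability in x is part of the claim; it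
  comes from the square integrability of both transforms and not from asymptotics of Gamma.\<close>

lemma pochhammer_Re_pos_nonzero:
  fixes z :: complex
  assumes "Re z > 0"
  shows "pochhammer z n \<noteq> 0"
proof
  assume "pochhammer z n = 0"
  then obtain k where "z = - of_nat k" by (auto simp: pochhammer_eq_0_iff)
  with assms show False by simp
qed

text \<open>The Chu-Vandermonde sum. Both the 3F2 transformation and the coefficients of the
  quadratic transformation rest on it.\<close>

lemma hypergeo_2F1_at_1_terminating:
  fixes a c :: complex
  assumes "Re c > 0"
  shows "(\<Sum>j\<le>n. pochhammer (- of_nat n) j * pochhammer a j / (pochhammer c j * fact j)) =
         pochhammer (c - a) n / pochhammer c n"
proof -
  have "\<forall>i\<in>{0..<n}. c \<noteq> - of_nat i"
    using assms by auto
  from Vandermonde_pochhammer[OF this, of a] show ?thesis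
    by (simp add: atMost_atLeast0 mult_ac)
qed

lemma pochhammer_neg_of_nat_div_fact:
  assumes "i \<le> j"
  shows "pochhammer (- of_nat j) i / fact j = (-1) ^ i / (fact (j - i) :: complex)"
proof -
  have "pochhammer (- of_nat j) i = (-1) ^ i * pochhammer (of_nat (j - i) + 1 :: complex) i"
    using assms by (simp add: pochhammer_minus of_nat_diff)
  moreover have "fact j = (fact (j - i) :: complex) * pochhammer (of_nat (j - i) + 1) i"
    using pochhammer_product'[of "1 :: complex" "j - i" i] assms
    by (simp add: pochhammer_fact add.commute)
  ultimately show ?thesis by (simp add: pochhammer_Re_pos_nonzero field_simps)
qed

text \<open>Chu-Vandermonde expands (b)_j / (e)_j into a sum over i with parameter e - b; after an
  exchange of sums, the sum over j is again of Chu-Vandermonde type. For d = 2 Re a and D = 2 Re c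
  the result interchanges the roles of a and c in a Hahn polynomial.\<close>

lemma hypergeo_3F2_at_1_terminating_reversal:
  fixes a b d e D :: complex
  assumes D: "a = d + D + of_nat n - 1" and pos: "Re d > 0" "Re D > 0" "Re e > 0"
  shows "pochhammer d n * (\<Sum>j\<le>n. pochhammer (- of_nat n) j * pochhammer a j * pochhammer b j /
            (pochhammer d j * pochhammer e j * fact j)) =
         (-1) ^ n * pochhammer D n * (\<Sum>j\<le>n. pochhammer (- of_nat n) j * pochhammer a j * pochhammer (e - b) j /
            (pochhammer D j * pochhammer e j * fact j))"
proof -
  note nz = pochhammer_Re_pos_nonzero[OF pos(1)] pochhammer_Re_pos_nonzero[OF pos(2)]
    pochhammer_Re_pos_nonzero[OF pos(3)]
  define P where "P = (\<lambda>j. pochhammer (- of_nat n) j * pochhammer a j / pochhammer d j)"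
  define Q where "Q = (\<lambda>i. pochhammer (e - b) i / (pochhammer e i * fact i))"
  have inner: "(\<Sum>j\<in>{i..n}. P j * (-1) ^ i / fact (j - i)) =
       (-1) ^ n * pochhammer D n / pochhammer d n * (pochhammer (- of_nat n) i * pochhammer a i / pochhammer D i)"
    if i: "i \<le> n" for i
  proof -
    have "(\<Sum>j\<in>{i..n}. P j * (-1) ^ i / fact (j - i)) = (\<Sum>m\<le>n - i. P (i + m) * (-1) ^ i / fact m)"
      by (rule sum.reindex_bij_witness[of _ "\<lambda>m. i + m" "\<lambda>j. j - i"]) (use i in auto)
    also have "\<dots> = P i * (-1) ^ i * (\<Sum>m\<le>n - i. pochhammer (- of_nat (n - i)) m *
        pochhammer (a + of_nat i) m / (pochhammer (d + of_nat i) m * fact m))"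
      unfolding P_def sum_distrib_left using i
      by (intro sum.cong refl) (simp add: pochhammer_product' of_nat_diff mult_ac)
    also have "(\<Sum>m\<le>n - i. pochhammer (- of_nat (n - i)) m *
        pochhammer (a + of_nat i) m / (pochhammer (d + of_nat i) m * fact m)) =
        pochhammer (d - a) (n - i) / pochhammer (d + of_nat i) (n - i)"
      using hypergeo_2F1_at_1_terminating[of "d + of_nat i" "n - i" "a + of_nat i"] pos by simp
    \<comment> \<open>The balance condition enters here: it turns the numerator of the Vandermonde
      value into a Pochhammer symbol of \<open>D\<close>.\<close>
    also have "d - a = - (D + of_nat n - 1)"
      using D by simp
    also have "pochhammer (- (D + of_nat n - 1)) (n - i) = (-1) ^ (n - i) * pochhammer (D + of_nat i) (n - i)"
      using i by (subst pochhammer_minus) (simp add: of_nat_diff algebra_simps)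
    also have "pochhammer (D + of_nat i) (n - i) = pochhammer D n / pochhammer D i"
      using pochhammer_product[OF i, of D] nz by (simp add: field_simps)
    also have "pochhammer (d + of_nat i) (n - i) = pochhammer d n / pochhammer d i"
      using pochhammer_product[OF i, of d] nz by (simp add: field_simps)
    also have "P i * (-1) ^ i * ((-1) ^ (n - i) * (pochhammer D n / pochhammer D i) / (pochhammer d n / pochhammer d i))
        = (-1) ^ (i + (n - i)) * pochhammer D n / pochhammer d n * (pochhammer (- of_nat n) i * pochhammer a i / pochhammer D i)"
      unfolding P_def power_add using nz by (simp add: field_simps)
    finally show ?thesis using i by simp
  qed
  have "(\<Sum>j\<le>n. pochhammer (- of_nat n) j * pochhammer a j * pochhammer b j /
            (pochhammer d j * pochhammer e j * fact j)) = (\<Sum>j\<le>n. \<Sum>i\<le>n. if i \<le> j then P j * (-1) ^ i / fact (j - i) * Q i else 0)"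
  proof (intro sum.cong refl)
    fix j assume j: "j \<in> {..n}"
    have ratio: "pochhammer b j / pochhammer e j = (\<Sum>i\<le>j. pochhammer (- of_nat j) i * pochhammer (e - b) i / (pochhammer e i * fact i))"
      using hypergeo_2F1_at_1_terminating[of e j "e - b"] pos by simp
    have "pochhammer (- of_nat n) j * pochhammer a j * pochhammer b j / (pochhammer d j * pochhammer e j * fact j)
      = P j / fact j * (pochhammer b j / pochhammer e j)"
      by (simp add: P_def mult_ac)
    also have "\<dots> = (\<Sum>i\<le>j. P j / fact j * (pochhammer (- of_nat j) i * pochhammer (e - b) i / (pochhammer e i * fact i)))"
      unfolding ratio sum_distrib_left ..
    also have "\<dots> = (\<Sum>i\<le>j. P j * (-1) ^ i / fact (j - i) * Q i)"
      by (intro sum.cong refl) (use pochhammer_neg_of_nat_div_fact[of _ j] in \<open>simp add: Q_def divide_simps\<close>)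
    also have "\<dots> = (\<Sum>i\<le>n. if i \<le> j then P j * (-1) ^ i / fact (j - i) * Q i else 0)"
      using j by (intro sum.mono_neutral_cong_left) auto
    finally show "pochhammer (- of_nat n) j * pochhammer a j * pochhammer b j / (pochhammer d j * pochhammer e j * fact j)
      = (\<Sum>i\<le>n. if i \<le> j then P j * (-1) ^ i / fact (j - i) * Q i else 0)" .
  qed
  also have "\<dots> = (\<Sum>i\<le>n. \<Sum>j\<le>n. if i \<le> j then P j * (-1) ^ i / fact (j - i) * Q i else 0)"
    by (rule sum.swap)
  also have "\<dots> = (\<Sum>i\<le>n. (\<Sum>j\<in>{i..n}. P j * (-1) ^ i / fact (j - i)) * Q i)"
    unfolding sum_distrib_right
    by (intro sum.cong[OF refl] sum.mono_neutral_cong_right) auto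
  also have "\<dots> = (\<Sum>i\<le>n. ((-1) ^ n * pochhammer D n / pochhammer d n) *
      (pochhammer (- of_nat n) i * pochhammer a i * pochhammer (e - b) i /
            (pochhammer D i * pochhammer e i * fact i)))"
    by (intro sum.cong refl) (simp add: inner Q_def mult.assoc)
  finally have eq: "(\<Sum>j\<le>n. pochhammer (- of_nat n) j * pochhammer a j * pochhammer b j /
            (pochhammer d j * pochhammer e j * fact j)) = \<dots>" .
  show ?thesis
    unfolding eq sum_distrib_left[symmetric] using nz by simp
qed

text \<open>The coefficients of 2F1(-k, k + 2g - 1; g; t). The parameter g is the one for which
  these polynomials are orthogonal with respect to (t(1 - t))^(g - 1) on the unit interval.\<close>

definition gegen_coeff :: "nat \<Rightarrow> complex \<Rightarrow> nat \<Rightarrow> complex" where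
  "gegen_coeff k g j = pochhammer (- of_nat k) j * pochhammer (of_nat k + 2 * g - 1) j / (pochhammer g j * fact j)"

text \<open>Up to normalisation, the Gegenbauer polynomial of index \<open>g - 1/2\<close> shifted to \<open>[0, 1]\<close>.\<close>

definition gegen_poly :: "nat \<Rightarrow> complex \<Rightarrow> complex poly" where
  "gegen_poly k g = (\<Sum>j\<le>k. monom (gegen_coeff k g j) j)"

lemma coeff_gegen_poly [simp]: "coeff (gegen_poly k g) j = gegen_coeff k g j"
  by (auto simp: gegen_poly_def coeff_sum gegen_coeff_def pochhammer_of_nat_eq_0_lemma)

lemma poly_gegen_poly: "poly (gegen_poly k g) t = (\<Sum>j\<le>k. gegen_coeff k g j * t ^ j)"
  by (simp add: gegen_poly_def poly_sum poly_monom)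

lemma gegen_poly_0 [simp]: "gegen_poly 0 g = 1"
  by (simp add: gegen_poly_def gegen_coeff_def monom_0)

text \<open>One step of the Rodrigues formula. Multiplied by (t(1 - t))^(g - 1), the right-hand side
  is the derivative of (t(1 - t))^g times the polynomial of degree k with parameter g + 1, so each
  integration by parts lowers k by one and raises g by one.\<close>

lemma gegen_poly_Suc:
  assumes g: "Re g > 0"
  shows "g * poly (gegen_poly (Suc k) g) t =
    g * (1 - 2 * t) * poly (gegen_poly k (g + 1)) t + t * (1 - t) * poly (pderiv (gegen_poly k (g + 1))) t"
proof -
  define h where "h = gegen_coeff k (g + 1)"
  define H where "H = gegen_poly k (g + 1)"
  have "smult g (gegen_poly (Suc k) g) =
    smult g (H - smult 2 (pCons 0 H)) + (pCons 0 (pderiv H) - pCons 0 (pCons 0 (pderiv H)))" (is "?L = ?R")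
  proof (rule poly_eqI)
    fix j
    show "coeff ?L j = coeff ?R j"
    proof (cases j)
      case 0
      then show ?thesis by (simp add: H_def gegen_coeff_def)
    next
      case (Suc i)
      have "g + 1 + of_nat i \<noteq> 0"
        using g by (auto simp: complex_eq_iff)
      moreover have "(1 + of_nat i :: complex) \<noteq> 0"
        by (metis of_nat_Suc of_nat_neq_0)
      ultimately have h_Suc: "(g + 1 + of_nat i) * h (Suc i) =
        (of_nat i - of_nat k) * (of_nat k + 2 * g + 1 + of_nat i) / (1 + of_nat i) * h i"
      proof -
        have "h (Suc i) = ((of_nat i - of_nat k) * pochhammer (- of_nat k) i) *
            ((of_nat k + 2 * g + 1 + of_nat i) * pochhammer (of_nat k + 2 * (g + 1) - 1) i) /
            (((g + 1 + of_nat i) * pochhammer (g + 1) i) * ((1 + of_nat i) * fact i))"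
          by (simp add: h_def gegen_coeff_def pochhammer_rec' algebra_simps)
        moreover have "G * ((N * X) * (K * Y) / ((G * Z) * (I * W))) = N * K / I * (X * Y / (Z * W))"
          if "G \<noteq> 0" for G N X K Y Z I W :: complex
          using that by (simp add: mult_ac)
        ultimately show ?thesis
          using \<open>g + 1 + of_nat i \<noteq> 0\<close> by (simp only: h_def gegen_coeff_def)
      qed
      have g_Suc: "g * gegen_coeff (Suc k) g (Suc i) = - (of_nat k + 1) * (of_nat k + 2 * g) / (1 + of_nat i) * h i"
      proof -
        have "gegen_coeff (Suc k) g (Suc i) = (- (of_nat k + 1) * pochhammer (- of_nat k) i) *
            ((of_nat k + 2 * g) * pochhammer (of_nat k + 2 * (g + 1) - 1) i) /
            ((g * pochhammer (g + 1) i) * ((1 + of_nat i) * fact i))"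
          by (simp add: gegen_coeff_def pochhammer_rec algebra_simps)
        moreover have "g * ((N * X) * (K * Y) / ((g * Z) * (I * W))) = N * K / I * (X * Y / (Z * W))"
          for N X K Y Z I W :: complex
          using g by (auto simp: mult_ac)
        ultimately show ?thesis by (simp only: h_def gegen_coeff_def)
      qed
      \<comment> \<open>Both \<open>h (Suc i)\<close> and the coefficient on the left are rational
        multiples of \<open>h i\<close>; what remains is (i - k)(k + 2g + 1 + i) - (1 + i)(2g + i) =
        -(k + 1)(k + 2g).\<close>
      have "coeff ?R j = g * (h (Suc i) - 2 * h i) + ((1 + of_nat i) * h (Suc i) - of_nat i * h i)"
        using Suc by (cases i) (auto simp: H_def h_def coeff_pderiv coeff_pCons)
      also have "\<dots> = (g + 1 + of_nat i) * h (Suc i) - (2 * g + of_nat i) * h i"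
        by (simp add: algebra_simps)
      also have "\<dots> = g * gegen_coeff (Suc k) g (Suc i)"
        unfolding h_Suc g_Suc using \<open>1 + of_nat i \<noteq> 0\<close> by (simp add: field_simps)
      finally show ?thesis using Suc by simp
    qed
  qed
  from arg_cong[OF this, of "\<lambda>p. poly p t"] show ?thesis
    by (simp add: H_def algebra_simps)
qed

section \<open>Parseval's identity\<close>

text \<open>A product of integrable functions of separate variables is integrable on the plane, and
  a kernel of modulus at most 1 preserves this. The kernels will be characters e^(ixu).\<close>

lemma Fubini_bounded_kernel:
  fixes p q :: "real \<Rightarrow> complex" and K :: "real \<Rightarrow> real \<Rightarrow> complex"
  assumes p: "integrable lborel p" and q: "integrable lborel q"
    and K [measurable]: "(\<lambda>(x, u). K x u) \<in> borel_measurable (borel \<Otimes>\<^sub>M borel)"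
    and K_le: "\<And>x u. norm (K x u) \<le> 1"
  shows "(\<integral>x. p x * (\<integral>u. q u * K x u \<partial>lborel) \<partial>lborel) =
         (\<integral>u. q u * (\<integral>x. p x * K x u \<partial>lborel) \<partial>lborel)"
proof -
  have [measurable]: "p \<in> borel_measurable lborel" "q \<in> borel_measurable lborel"
    using p q by auto
  have "integrable (lborel \<Otimes>\<^sub>M lborel) (\<lambda>(x, u). p x * q u)"
    by (rule lborel_pair.Fubini_integrable)
       (use p q in \<open>auto simp: norm_mult intro!: integrable_mult_left integrable_norm\<close>)
  then have "integrable (lborel \<Otimes>\<^sub>M lborel) (\<lambda>(x, u). p x * q u * K x u)"
    by (rule Bochner_Integration.integrable_bound)
       (auto simp: norm_mult intro!: AE_I2 mult_right_le_one_le K_le)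
  from lborel_pair.Fubini_integral[OF this]
  have "(\<integral>x. (\<integral>u. p x * q u * K x u \<partial>lborel) \<partial>lborel) =
        (\<integral>u. (\<integral>x. p x * q u * K x u \<partial>lborel) \<partial>lborel)" by simp
  moreover have "(\<integral>u. p x * q u * K x u \<partial>lborel) = p x * (\<integral>u. q u * K x u \<partial>lborel)" for x
    unfolding mult.assoc by (rule integral_mult_right_zero)
  moreover have "(\<integral>x. p x * q u * K x u \<partial>lborel) = q u * (\<integral>x. p x * K x u \<partial>lborel)" for u
    unfolding integral_mult_right_zero[symmetric] by (simp add: mult_ac)
  ultimately show ?thesis by simp
qed

lemma integral_std_normal_density_iexp:
  "(\<integral>y. of_real (std_normal_density y) * iexp (t * y) \<partial>lborel) = of_real (exp (- t\<^sup>2 / 2))"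
proof -
  have "(\<integral>y. of_real (std_normal_density y) * iexp (t * y) \<partial>lborel) = char std_normal_distribution t"
    unfolding char_def
    by (subst integral_density) (auto simp: scaleR_conv_of_real)
  then show ?thesis
    by (simp add: char_std_normal_distribution)
qed

lemma integrable_mult_iexp:
  fixes f :: "real \<Rightarrow> complex"
  assumes "integrable lborel f"
  shows "integrable lborel (\<lambda>u. f u * iexp (x * u))"
  by (rule Bochner_Integration.integrable_bound[OF assms])
     (use assms in \<open>auto simp: norm_mult\<close>)

lemma fourier_transform_measurable [measurable]:
  fixes f :: "real \<Rightarrow> complex"
  assumes [measurable]: "f \<in> borel_measurable borel"
  shows "(\<lambda>x. \<integral>u. f u * iexp (x * u) \<partial>lborel) \<in> borel_measurable borel"
  by measurable

lemma norm_fourier_transform_le: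
  fixes f :: "real \<Rightarrow> complex"
  shows "norm (\<integral>u. f u * iexp (x * u) \<partial>lborel) \<le> (\<integral>u. norm (f u) \<partial>lborel)"
  using integral_norm_bound[of lborel "\<lambda>u. f u * iexp (x * u)"] by (simp add: norm_mult)

text \<open>The Gaussian factor makes the integral over x absolutely convergent, so Fubini applies
  although nothing is known yet about the decay of the transforms. Its own Fourier transform is
  Gaussian again, which leaves f averaged over a normal distribution of standard deviation
  \<open>e\<close>.\<close>

lemma parseval_regularized:
  fixes f g :: "real \<Rightarrow> complex"
  assumes f: "integrable lborel f" and g: "integrable lborel g" and e: "e > 0"
  shows "(\<integral>x. of_real (exp (- (e * x)\<^sup>2 / 2)) *
             ((\<integral>u. f u * iexp (x * u) \<partial>lborel) * (\<integral>v. g v * iexp (- x * v) \<partial>lborel)) \<partial>lborel) =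
         2 * pi * (\<integral>v. g v * (\<integral>s. of_real (std_normal_density s) * f (v + e * s) \<partial>lborel) \<partial>lborel)"
proof -
  define F where "F = (\<lambda>x. \<integral>u. f u * iexp (x * u) \<partial>lborel)"
  define G where "G = (\<lambda>x. \<integral>v. g v * iexp (- x * v) \<partial>lborel)"
  define N where "N = (\<lambda>y. complex_of_real (std_normal_density y))"
  have [measurable]: "f \<in> borel_measurable borel" "g \<in> borel_measurable borel"
    using f g by auto
  have [measurable]: "F \<in> borel_measurable borel" unfolding F_def by measurable
  have [measurable]: "N \<in> borel_measurable borel" unfolding N_def by measurable
  have N: "integrable lborel N"
    unfolding N_def by (intro integrable_of_real integrable_normal_density) auto
  have F_le: "norm (F x) \<le> (\<integral>u. norm (f u) \<partial>lborel)" for x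
    unfolding F_def by (rule norm_fourier_transform_le)
  have NF: "integrable lborel (\<lambda>y. N y * F (y / e))"
  proof (rule Bochner_Integration.integrable_bound)
    show "integrable lborel (\<lambda>y. N y * of_real (\<integral>u. norm (f u) \<partial>lborel))"
      using N by (rule integrable_mult_left)
    show "AE y in lborel. norm (N y * F (y / e)) \<le> norm (N y * of_real (\<integral>u. norm (f u) \<partial>lborel))"
      unfolding norm_mult
      by (intro AE_I2 mult_left_mono) (auto intro: order_trans[OF F_le])
  qed auto
  \<comment> \<open>The substitution y = e x turns the damping factor into the standard normal
    density. The factor \<open>e\<close> cancels later against the one from u = v + e s.\<close>
  have "e * (\<integral>x. N (e * x) * (F x * G x) \<partial>lborel) = (\<integral>y. N y * (F (y / e) * G (y / e)) \<partial>lborel)"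
    using lborel_integral_real_affine[of e "\<lambda>y. N y * (F (y / e) * G (y / e))" 0] e
    by (simp add: scaleR_conv_of_real)
  also have "\<dots> = (\<integral>y. (N y * F (y / e)) * (\<integral>v. g v * iexp (- (y / e) * v) \<partial>lborel) \<partial>lborel)"
    by (simp add: G_def mult_ac)
  also have "\<dots> = (\<integral>v. g v * (\<integral>y. (N y * F (y / e)) * iexp (- (y / e) * v) \<partial>lborel) \<partial>lborel)"
    by (rule Fubini_bounded_kernel[OF NF g]) auto
  also have "\<dots> = (\<integral>v. g v * (e * (\<integral>s. of_real (exp (- s\<^sup>2 / 2)) * f (v + e * s) \<partial>lborel)) \<partial>lborel)"
  proof (intro Bochner_Integration.integral_cong refl arg_cong2[where f = "(*)"])
    fix v
    have Ni: "integrable lborel (\<lambda>y. N y * iexp (- (y / e) * v))"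
      using integrable_mult_iexp[OF N, of "- v / e"] by (simp add: mult_ac)
    have "(\<integral>y. (N y * F (y / e)) * iexp (- (y / e) * v) \<partial>lborel) =
          (\<integral>y. (N y * iexp (- (y / e) * v)) * (\<integral>u. f u * iexp (y / e * u) \<partial>lborel) \<partial>lborel)"
      by (simp add: F_def mult_ac)
    also have "\<dots> = (\<integral>u. f u * (\<integral>y. N y * iexp (- (y / e) * v) * iexp (y / e * u) \<partial>lborel) \<partial>lborel)"
      by (rule Fubini_bounded_kernel[OF Ni f]) auto
    also have "\<dots> = (\<integral>u. f u * (\<integral>y. N y * iexp ((u - v) / e * y) \<partial>lborel) \<partial>lborel)"
      by (simp add: mult.assoc exp_add[symmetric] algebra_simps diff_divide_distrib)
    also have "\<dots> = (\<integral>u. f u * of_real (exp (- ((u - v) / e)\<^sup>2 / 2)) \<partial>lborel)"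
      unfolding N_def integral_std_normal_density_iexp ..
    also have "\<dots> = e * (\<integral>s. f (v + e * s) * of_real (exp (- s\<^sup>2 / 2)) \<partial>lborel)"
      using e by (subst lborel_integral_real_affine[of e _ v]) (auto simp: scaleR_conv_of_real)
    finally show "(\<integral>y. (N y * F (y / e)) * iexp (- (y / e) * v) \<partial>lborel) =
       e * (\<integral>s. of_real (exp (- s\<^sup>2 / 2)) * f (v + e * s) \<partial>lborel)"
      by (simp add: mult_ac)
  qed
  also have "\<dots> = e * (\<integral>v. g v * (\<integral>s. of_real (exp (- s\<^sup>2 / 2)) * f (v + e * s) \<partial>lborel) \<partial>lborel)"
    by (subst integral_mult_right_zero[symmetric]) (simp add: mult_ac)
  finally have *: "(\<integral>x. N (e * x) * (F x * G x) \<partial>lborel) =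
      (\<integral>v. g v * (\<integral>s. of_real (exp (- s\<^sup>2 / 2)) * f (v + e * s) \<partial>lborel) \<partial>lborel)"
    using e by simp
  \<comment> \<open>This normalisation is used twice, for the damping factor and for the transform
    of \<open>N\<close>; the two square roots make up the constant 2 pi.\<close>
  have N_eq: "of_real (exp (- y\<^sup>2 / 2)) = sqrt (2 * pi) * N y" for y
  proof -
    have "exp (- y\<^sup>2 / 2) = sqrt (2 * pi) * std_normal_density y"
      by (simp add: std_normal_density_def)
    then show ?thesis by (simp only: N_def of_real_mult)
  qed
  have "(\<integral>x. of_real (exp (- (e * x)\<^sup>2 / 2)) * (F x * G x) \<partial>lborel) =
        sqrt (2 * pi) * (\<integral>x. N (e * x) * (F x * G x) \<partial>lborel)"
    by (subst integral_mult_right_zero[symmetric], simp only: N_eq mult.assoc)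
  also have "\<dots> = sqrt (2 * pi) * (\<integral>v. g v * (sqrt (2 * pi) * (\<integral>s. N s * f (v + e * s) \<partial>lborel)) \<partial>lborel)"
    unfolding * N_eq mult.assoc integral_mult_right_zero ..
  also have "\<dots> = (sqrt (2 * pi) * sqrt (2 * pi)) * (\<integral>v. g v * (\<integral>s. N s * f (v + e * s) \<partial>lborel) \<partial>lborel)"
    unfolding mult.left_commute[of "g _"] integral_mult_right_zero
    by (simp only: of_real_mult mult.assoc)
  also have "complex_of_real (sqrt (2 * pi) * sqrt (2 * pi)) = 2 * pi"
    by simp
  finally show ?thesis
    by (simp add: F_def G_def N_def)
qed

text \<open>As the damping disappears, the normal averages form an approximate identity: continuity
  of f gives their pointwise convergence, and the bound \<open>M\<close> supplies the majorants for
  the inner and the outer integral.\<close>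

lemma parseval_limit:
  fixes f g :: "real \<Rightarrow> complex"
  assumes f: "integrable lborel f" and g: "integrable lborel g"
    and cont: "continuous_on UNIV f" and bnd: "\<And>u. norm (f u) \<le> M"
  shows "(\<lambda>n. \<integral>x. of_real (exp (- (inverse (Suc n) * x)\<^sup>2 / 2)) *
             ((\<integral>u. f u * iexp (x * u) \<partial>lborel) * (\<integral>v. g v * iexp (- x * v) \<partial>lborel)) \<partial>lborel)
         \<longlonglongrightarrow> 2 * pi * (\<integral>v. f v * g v \<partial>lborel)"
proof -
  have [measurable]: "f \<in> borel_measurable borel" "g \<in> borel_measurable borel"
    using f g by auto
  define N where "N = (\<lambda>y. complex_of_real (std_normal_density y))"
  have [measurable]: "N \<in> borel_measurable borel" unfolding N_def by measurable
  have N: "integrable lborel N"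
    unfolding N_def by (intro integrable_of_real integrable_normal_density) auto
  have N1: "(\<integral>s. norm (N s) \<partial>lborel) = 1" "(\<integral>s. N s \<partial>lborel) = 1"
    using integral_normal_density[of 1 0] by (auto simp: N_def simp flip: of_real_def)
  have inner: "(\<lambda>n. \<integral>s. N s * f (v + inverse (Suc n) * s) \<partial>lborel) \<longlonglongrightarrow> f v" for v
  proof -
    have "(\<lambda>n. \<integral>s. N s * f (v + inverse (Suc n) * s) \<partial>lborel) \<longlonglongrightarrow> (\<integral>s. N s * f v \<partial>lborel)"
    proof (rule integral_dominated_convergence[where w = "\<lambda>s. norm (N s) * M"])
      show "AE s in lborel. (\<lambda>n. N s * f (v + inverse (Suc n) * s)) \<longlonglongrightarrow> N s * f v"
      proof (intro AE_I2 tendsto_intros)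
        fix s
        have "isCont f v"
          using cont by (simp add: continuous_on_eq_continuous_at)
        moreover have "(\<lambda>n. v + inverse (Suc n) * s) \<longlonglongrightarrow> v + 0 * s"
          by (intro tendsto_intros LIMSEQ_inverse_real_of_nat)
        ultimately show "(\<lambda>n. f (v + inverse (Suc n) * s)) \<longlonglongrightarrow> f v"
          by (intro isCont_tendsto_compose[of v f]) auto
      qed
    qed (use N bnd in \<open>auto simp: norm_mult intro!: mult_left_mono\<close>)
    also have "(\<integral>s. N s * f v \<partial>lborel) = f v" using N1 by simp
    finally show ?thesis .
  qed
  have le: "norm (\<integral>s. N s * f (v + inverse (Suc n) * s) \<partial>lborel) \<le> M" for v n
  proof -
    have "norm (\<integral>s. N s * f (v + inverse (Suc n) * s) \<partial>lborel) \<le> (\<integral>s. norm (N s * f (v + inverse (Suc n) * s)) \<partial>lborel)"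
      by (rule integral_norm_bound)
    also have "\<dots> \<le> (\<integral>s. norm (N s) * M \<partial>lborel)"
      by (intro integral_mono' integrable_mult_left integrable_norm N)
         (use bnd order_trans[OF norm_ge_zero bnd] in \<open>auto simp: norm_mult intro!: mult_left_mono\<close>)
    also have "\<dots> = M" using N1 by simp
    finally show ?thesis .
  qed
  have "(\<lambda>n. \<integral>v. g v * (\<integral>s. N s * f (v + inverse (Suc n) * s) \<partial>lborel) \<partial>lborel) \<longlonglongrightarrow> (\<integral>v. g v * f v \<partial>lborel)"
  proof (rule integral_dominated_convergence[where w = "\<lambda>v. norm (g v) * M"])
    show "AE v in lborel. (\<lambda>n. g v * (\<integral>s. N s * f (v + inverse (Suc n) * s) \<partial>lborel)) \<longlonglongrightarrow> g v * f v"
      by (intro AE_I2 tendsto_intros inner)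
  qed (use g le in \<open>auto simp: norm_mult intro!: mult_left_mono\<close>)
  then have "(\<lambda>n. 2 * pi * (\<integral>v. g v * (\<integral>s. N s * f (v + inverse (Suc n) * s) \<partial>lborel) \<partial>lborel))
    \<longlonglongrightarrow> 2 * pi * (\<integral>v. g v * f v \<partial>lborel)"
    by (intro tendsto_intros)
  moreover have "(\<integral>x. of_real (exp (- (inverse (Suc n) * x)\<^sup>2 / 2)) *
             ((\<integral>u. f u * iexp (x * u) \<partial>lborel) * (\<integral>v. g v * iexp (- x * v) \<partial>lborel)) \<partial>lborel)
       = 2 * pi * (\<integral>v. g v * (\<integral>s. N s * f (v + inverse (Suc n) * s) \<partial>lborel) \<partial>lborel)" for n
    unfolding N_def by (rule parseval_regularized[OF f g]) simp
  ultimately show ?thesis by (simp only: mult.commute[of "f _"])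
qed

text \<open>For g = cnj f the damped integrands are nonnegative and increase to |F|^2, while their
  integrals converge by \<open>parseval_limit\<close>. Monotone convergence then yields
  integrability itself, which dominated convergence could not.\<close>

lemma integrable_fourier_square:
  fixes f :: "real \<Rightarrow> complex"
  assumes f: "integrable lborel f"
    and cont: "continuous_on UNIV f" and bnd: "\<And>u. norm (f u) \<le> M"
  shows "integrable lborel (\<lambda>x. (norm (\<integral>u. f u * iexp (x * u) \<partial>lborel))\<^sup>2)"
proof -
  define F where "F = (\<lambda>x. \<integral>u. f u * iexp (x * u) \<partial>lborel)"
  define E where "E = (\<lambda>(n::nat) x. exp (- (inverse (Suc n) * x)\<^sup>2 / 2))"
  have [measurable]: "f \<in> borel_measurable borel"
    using f by auto
  have [measurable]: "F \<in> borel_measurable borel" unfolding F_def by measurable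
  have "(\<integral>v. cnj (f v) * iexp (- x * v) \<partial>lborel) = cnj (F x)" for x
    unfolding F_def Bochner_Integration.integral_cnj[symmetric]
    by (simp add: exp_cnj del: Bochner_Integration.integral_cnj)
  then have "(\<lambda>n. \<integral>x. of_real (E n x) * (F x * cnj (F x)) \<partial>lborel)
     \<longlonglongrightarrow> 2 * pi * (\<integral>v. f v * cnj (f v) \<partial>lborel)"
    using parseval_limit[OF f _ cont bnd, of "\<lambda>v. cnj (f v)"] f
    by (simp add: F_def E_def)
  then have "(\<lambda>n. Re (\<integral>x. of_real (E n x) * (F x * cnj (F x)) \<partial>lborel))
     \<longlonglongrightarrow> Re (2 * pi * (\<integral>v. f v * cnj (f v) \<partial>lborel))"
    by (rule tendsto_Re)
  moreover have "(\<integral>x. of_real (E n x) * (F x * cnj (F x)) \<partial>lborel) = of_real (\<integral>x. E n x * (norm (F x))\<^sup>2 \<partial>lborel)" for n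
    unfolding integral_complex_of_real[symmetric] complex_norm_square[symmetric] by simp
  ultimately have lim: "(\<lambda>n. \<integral>x. E n x * (norm (F x))\<^sup>2 \<partial>lborel) \<longlonglongrightarrow> Re (2 * pi * (\<integral>v. f v * cnj (f v) \<partial>lborel))"
    by simp
  have "integrable lborel (\<lambda>x. (norm (F x))\<^sup>2)"
  proof (rule integrable_monotone_convergence[OF _ _ _ lim])
    show "integrable lborel (\<lambda>x. E n x * (norm (F x))\<^sup>2)" for n
    proof (rule Bochner_Integration.integrable_bound)
      have "integrable lborel (\<lambda>x. std_normal_density (0 + inverse (Suc n) * x))"
        by (rule lborel_integrable_real_affine) (auto intro!: integrable_normal_density)
      then show "integrable lborel (\<lambda>x. (sqrt (2 * pi) * std_normal_density (inverse (Suc n) * x)) *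
         (\<integral>u. norm (f u) \<partial>lborel)\<^sup>2)"
        by (intro integrable_mult_left integrable_mult_right) simp
      have "E n x = sqrt (2 * pi) * std_normal_density (inverse (Suc n) * x)" for x
        by (simp add: E_def std_normal_density_def)
      moreover have "(norm (F x))\<^sup>2 \<le> (\<integral>u. norm (f u) \<partial>lborel)\<^sup>2" for x
        unfolding F_def by (intro power_mono norm_fourier_transform_le) auto
      ultimately show "AE x in lborel. norm (E n x * (norm (F x))\<^sup>2) \<le>
        norm ((sqrt (2 * pi) * std_normal_density (inverse (Suc n) * x)) * (\<integral>u. norm (f u) \<partial>lborel)\<^sup>2)"
        by (intro AE_I2) (auto simp: abs_mult intro!: mult_left_mono)
      show "(\<lambda>x. E n x * (norm (F x))\<^sup>2) \<in> borel_measurable lborel"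
        unfolding E_def by measurable
    qed
    have "E m x \<le> E n x" if "m \<le> n" for m n x
    proof -
      have "\<bar>inverse (real (Suc n)) * x\<bar> \<le> \<bar>inverse (real (Suc m)) * x\<bar>"
        using that by (auto simp: abs_mult intro!: mult_right_mono le_imp_inverse_le)
      then have "(inverse (real (Suc n)) * x)\<^sup>2 \<le> (inverse (real (Suc m)) * x)\<^sup>2"
        by (simp only: abs_le_square_iff)
      then show ?thesis by (simp add: E_def)
    qed
    then show "AE x in lborel. mono (\<lambda>n. E n x * (norm (F x))\<^sup>2)"
      by (intro AE_I2 monoI mult_right_mono) auto
    have "(\<lambda>n. E n x) \<longlonglongrightarrow> exp (- (0 * x)\<^sup>2 / 2)" for x
      unfolding E_def by (intro tendsto_intros LIMSEQ_inverse_real_of_nat) auto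
    from tendsto_mult[OF this tendsto_const]
    show "AE x in lborel. (\<lambda>n. E n x * (norm (F x))\<^sup>2) \<longlonglongrightarrow> (norm (F x))\<^sup>2"
      by (intro AE_I2) simp
  qed auto
  then show ?thesis by (simp add: F_def)
qed

text \<open>The product of the transforms is dominated by the sum of their squared moduli, which are
  integrable. With this majorant at hand the Gaussian damping can be removed by dominated
  convergence.\<close>

theorem parseval:
  fixes f g :: "real \<Rightarrow> complex"
  assumes f: "integrable lborel f" "continuous_on UNIV f" "\<And>u. norm (f u) \<le> M"
    and g: "integrable lborel g" "continuous_on UNIV g" "\<And>u. norm (g u) \<le> M'"
  shows "has_bochner_integral lborel
    (\<lambda>x. (\<integral>u. f u * iexp (x * u) \<partial>lborel) * (\<integral>v. g v * iexp (- x * v) \<partial>lborel))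
    (2 * pi * (\<integral>v. f v * g v \<partial>lborel))"
proof -
  define F where "F = (\<lambda>x. \<integral>u. f u * iexp (x * u) \<partial>lborel)"
  define G where "G = (\<lambda>x. \<integral>v. g v * iexp (- x * v) \<partial>lborel)"
  define E where "E = (\<lambda>(n::nat) x. exp (- (inverse (Suc n) * x)\<^sup>2 / 2))"
  have [measurable]: "f \<in> borel_measurable borel" "g \<in> borel_measurable borel"
    using f g by auto
  have [measurable]: "F \<in> borel_measurable borel" "G \<in> borel_measurable borel"
    unfolding F_def G_def by measurable
  have F2: "integrable lborel (\<lambda>x. (norm (F x))\<^sup>2)"
    unfolding F_def by (rule integrable_fourier_square) (use f in auto)
  \<comment> \<open>\<open>G\<close> is a transform taken at -x, so the square integrability is
    obtained for the reflected function and carried back by x \<mapsto> -x.\<close>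
  have "integrable lborel (\<lambda>x. (norm (G (0 + (-1) * x)))\<^sup>2)"
    unfolding G_def using integrable_fourier_square[OF g] by simp
  then have G2: "integrable lborel (\<lambda>x. (norm (G x))\<^sup>2)"
    by (subst (asm) lborel_integrable_real_affine_iff) auto
  have int: "integrable lborel (\<lambda>x. F x * G x)"
  proof (rule Bochner_Integration.integrable_bound)
    show "integrable lborel (\<lambda>x. (norm (F x))\<^sup>2 + (norm (G x))\<^sup>2)"
      using F2 G2 by (rule Bochner_Integration.integrable_add)
    have "norm (F x * G x) \<le> (norm (F x))\<^sup>2 + (norm (G x))\<^sup>2" for x
    proof -
      have "norm (F x) * norm (G x) \<le> 2 * norm (F x) * norm (G x)" by simp
      also have "\<dots> \<le> (norm (F x))\<^sup>2 + (norm (G x))\<^sup>2"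
        by (rule sum_squares_bound)
      finally show ?thesis by (simp add: norm_mult)
    qed
    then show "AE x in lborel. norm (F x * G x) \<le> norm ((norm (F x))\<^sup>2 + (norm (G x))\<^sup>2)"
      by (intro AE_I2) auto
  qed auto
  have "(\<lambda>n. \<integral>x. of_real (E n x) * (F x * G x) \<partial>lborel) \<longlonglongrightarrow> (\<integral>x. F x * G x \<partial>lborel)"
  proof (rule integral_dominated_convergence[where w = "\<lambda>x. norm (F x * G x)"])
    have "(\<lambda>n. E n x) \<longlonglongrightarrow> exp (- (0 * x)\<^sup>2 / 2)" for x
      unfolding E_def by (intro tendsto_intros LIMSEQ_inverse_real_of_nat) auto
    then show "AE x in lborel. (\<lambda>n. of_real (E n x) * (F x * G x)) \<longlonglongrightarrow> F x * G x"
      by (intro AE_I2) (auto intro!: tendsto_eq_intros)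
    show "AE x in lborel. norm (of_real (E n x) * (F x * G x)) \<le> norm (F x * G x)" for n
      by (intro AE_I2) (auto simp: E_def norm_mult intro!: mult_left_le_one_le)
    show "(\<lambda>x. of_real (E n x) * (F x * G x)) \<in> borel_measurable lborel" for n
      unfolding E_def by measurable
  qed (use int in auto)
  moreover have "(\<lambda>n. \<integral>x. of_real (E n x) * (F x * G x) \<partial>lborel) \<longlonglongrightarrow> 2 * pi * (\<integral>v. f v * g v \<partial>lborel)"
    unfolding E_def F_def G_def by (rule parseval_limit) (use f g in auto)
  ultimately have "(\<integral>x. F x * G x \<partial>lborel) = 2 * pi * (\<integral>v. f v * g v \<partial>lborel)"
    by (rule LIMSEQ_unique)
  with int show ?thesis
    unfolding F_def G_def by (simp add: has_bochner_integral_iff)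
qed

section \<open>Parametric integrals and the Beta integral\<close>

text \<open>Local domination of the integrand alone suffices: Cauchy's inequality converts it into a
  bound for the derivative in z, hence for the difference quotients, and dominated convergence
  differentiates under the integral.\<close>

lemma holomorphic_on_integral:
  fixes F :: "complex \<Rightarrow> 'a \<Rightarrow> complex"
  assumes U: "open U"
    and meas [measurable]: "\<And>z. z \<in> U \<Longrightarrow> F z \<in> borel_measurable M"
    and hol: "\<And>t. (\<lambda>z. F z t) holomorphic_on U"
    and dom: "\<And>z0. z0 \<in> U \<Longrightarrow> \<exists>r>0. \<exists>h. cball z0 r \<subseteq> U \<and> integrable M h \<and>
                (\<forall>z\<in>cball z0 r. \<forall>t. norm (F z t) \<le> h t)"
  shows "(\<lambda>z. \<integral>t. F z t \<partial>M) holomorphic_on U"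
proof -
  have "(\<lambda>z. \<integral>t. F z t \<partial>M) field_differentiable at z0" if z0: "z0 \<in> U" for z0
  proof -
    from dom[OF z0] obtain r h where r: "r > 0" "cball z0 r \<subseteq> U" and h: "integrable M h"
      and le: "\<And>z t. z \<in> cball z0 r \<Longrightarrow> norm (F z t) \<le> h t" by blast
    \<comment> \<open>Half of the radius is kept in reserve: around every point of \<open>B\<close>
      a disc of radius r/2 still lies in \<open>cball z0 r\<close>, where \<open>h\<close>
      dominates.\<close>
    define B where "B = ball z0 (r / 2)"
    have BU: "B \<subseteq> U" using r by (auto simp: B_def)
    have z0B: "z0 \<in> B" using r by (simp add: B_def)
    have int: "integrable M (F z)" if "z \<in> B" for z
      by (rule Bochner_Integration.integrable_bound[OF h])
         (use that BU r le[of z] in \<open>auto simp: B_def intro!: AE_I2 intro: order_trans[OF _ abs_ge_self]\<close>)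
    define F' where "F' = (\<lambda>z t. deriv (\<lambda>z. F z t) z)"
    have F': "((\<lambda>z. F z t) has_field_derivative F' z t) (at z)" if "z \<in> U" for z t
      unfolding F'_def using hol U that by (rule holomorphic_derivI)
    have F'_le: "norm (F' z t) \<le> h t / (r / 2)" if "z \<in> B" for z t
    proof -
      have sub: "cball z (r / 2) \<subseteq> cball z0 r"
        using that r by (intro cball_subset_cball_iff[THEN iffD2])  (auto simp: B_def dist_commute)
      have holz: "(\<lambda>z. F z t) holomorphic_on cball z (r / 2)"
        using hol by (rule holomorphic_on_subset) (use sub r in auto)
      have "norm ((deriv ^^ 1) (\<lambda>z. F z t) z) \<le> fact 1 * h t / (r / 2) ^ 1"
      proof (rule Cauchy_inequality)
        show "(\<lambda>z. F z t) holomorphic_on ball z (r / 2)"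
          using holz by (rule holomorphic_on_subset) auto
        show "continuous_on (cball z (r / 2)) (\<lambda>z. F z t)"
          using holz by (rule holomorphic_on_imp_continuous_on)
        show "norm (F x t) \<le> h t" if "norm (z - x) = r / 2" for x
          by (rule le, rule subsetD[OF sub]) (use that in \<open>auto simp: dist_norm\<close>)
      qed (use r in auto)
      then show ?thesis by (simp add: F'_def)
    qed
    have lip: "norm (F w t - F z0 t) \<le> h t / (r / 2) * norm (w - z0)" if "w \<in> B" for w t
    proof (rule field_differentiable_bound[of B])
      show "((\<lambda>w. F w t) has_field_derivative F' z t) (at z within B)" if "z \<in> B" for z
        using F'[of z t] that BU by (auto intro: has_field_derivative_at_within)
    qed (use that z0B F'_le in \<open>auto simp: B_def\<close>)
    have "((\<lambda>z. \<integral>t. F z t \<partial>M) has_field_derivative (\<integral>t. F' z0 t \<partial>M)) (at z0 within B)"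
      unfolding has_field_derivative_iff tendsto_at_iff_sequentially
    proof (intro allI impI)
      fix X assume X: "\<forall>i. X i \<in> B - {z0}" "X \<longlonglongrightarrow> z0"
      have lim: "(\<lambda>i. (F (X i) t - F z0 t) / (X i - z0)) \<longlonglongrightarrow> F' z0 t" for t
        using F'[OF z0, of t] X unfolding has_field_derivative_iff tendsto_at_iff_sequentially
        by (auto simp: o_def)
      have [measurable]: "F (X i) \<in> borel_measurable M" "F z0 \<in> borel_measurable M" for i
        using X BU z0 by (auto intro!: meas)
      have meas': "(\<lambda>t. (F (X i) t - F z0 t) / (X i - z0)) \<in> borel_measurable M" for i
        by measurable
      have "(\<lambda>i. \<integral>t. (F (X i) t - F z0 t) / (X i - z0) \<partial>M) \<longlonglongrightarrow> (\<integral>t. F' z0 t \<partial>M)"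
      proof (rule integral_dominated_convergence)
        show "integrable M (\<lambda>t. h t / (r / 2))"
          using h by simp
        show "(\<lambda>t. F' z0 t) \<in> borel_measurable M"
          by (rule borel_measurable_LIMSEQ_metric[OF meas' lim])
        show "AE t in M. norm ((F (X i) t - F z0 t) / (X i - z0)) \<le> h t / (r / 2)" for i
        proof (rule AE_I2)
          fix t
          have "norm (X i - z0) > 0" "X i \<in> B" using X by auto
          with lip[of "X i" t] show "norm ((F (X i) t - F z0 t) / (X i - z0)) \<le> h t / (r / 2)"
            by (simp add: norm_divide pos_divide_le_eq)
        qed
      qed (use lim meas' in auto)
      moreover have "(\<integral>t. (F (X i) t - F z0 t) / (X i - z0) \<partial>M) =
        ((\<integral>t. F (X i) t \<partial>M) - (\<integral>t. F z0 t \<partial>M)) / (X i - z0)" for i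
      proof -
        have "integrable M (F (X i))" "integrable M (F z0)"
          using X int z0B by auto
        then show ?thesis
          by (simp add: Bochner_Integration.integral_diff)
      qed
      ultimately show "((\<lambda>z. ((\<integral>t. F z t \<partial>M) - (\<integral>t. F z0 t \<partial>M)) / (z - z0)) \<circ> X) \<longlonglongrightarrow> (\<integral>t. F' z0 t \<partial>M)"
        by (simp only: o_def)
    qed
    moreover have "at z0 within B = at z0"
      using z0B by (intro at_within_open) (auto simp: B_def)
    ultimately show ?thesis by (auto simp: field_differentiable_def)
  qed
  then show ?thesis
    using U by (simp add: holomorphic_on_open field_differentiable_def)
qed

lemma of_real_islimpt_greaterThanLessThan:
  assumes "x < (y :: real)"
  shows "complex_of_real x islimpt of_real ` {x<..<y}"
proof -
  have "x islimpt {x<..<y}"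
    using assms by (simp add: islimpt_greaterThanLessThan1)
  then show ?thesis
    unfolding islimpt_approachable by (force simp: dist_of_real)
qed

text \<open>The identity theorem with the left endpoint as accumulation point. It lifts formulas
  from real exponents to complex ones, and later the quadratic transformation from small real \<rho>
  to the disc.\<close>

lemma holomorphic_eq_from_real_interval:
  assumes "f holomorphic_on S" "g holomorphic_on S" "open S" "connected S"
    and "x < y" "of_real ` {x..<y} \<subseteq> S"
    and eq: "\<And>t. x < t \<Longrightarrow> t < y \<Longrightarrow> f (of_real t) = g (of_real t)"
    and "z \<in> S"
  shows "f z = (g z :: complex)"
proof -
  have "f z - g z = 0"
  proof (rule analytic_continuation[of "\<lambda>z. f z - g z" S "of_real ` {x<..<y}" "of_real x" z])
    show "(\<lambda>z. f z - g z) holomorphic_on S"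
      using assms by (intro holomorphic_intros)
    show "complex_of_real x islimpt of_real ` {x<..<y}"
      by (rule of_real_islimpt_greaterThanLessThan) fact
  qed (use assms in auto)
  then show ?thesis by simp
qed

section \<open>The logistic substitution and the Beta integral with complex exponents\<close>

definition logistic :: "real \<Rightarrow> real" where
  "logistic u = 1 / (1 + exp (- u))"

lemma logistic_pos [simp]: "0 < logistic u" and logistic_less_1 [simp]: "logistic u < 1"
  by (simp_all add: logistic_def add_pos_pos)

lemma logistic_bounds [simp]: "0 \<le> logistic u" "logistic u \<le> 1"
  using logistic_pos[of u] logistic_less_1[of u] by linarith+

lemma logistic_nonzero [simp]: "logistic u \<noteq> 0" "logistic u \<noteq> 1" "1 - logistic u \<noteq> 0"
  using logistic_pos[of u] logistic_less_1[of u] by linarith+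

lemma exp_pos_plus_1_nonzero [simp]: "1 + exp (u :: real) \<noteq> 0"
  using exp_gt_zero[of u] by linarith

lemma one_minus_logistic: "1 - logistic u = exp (- u) * logistic u"
  by (simp add: logistic_def field_simps)

lemma logistic_deriv: "(logistic has_real_derivative logistic u * (1 - logistic u)) (at u within A)"
  unfolding one_minus_logistic
  unfolding logistic_def
  by (auto intro!: derivative_eq_intros simp: power2_eq_square)

lemma continuous_on_logistic [continuous_intros]:
  "continuous_on A f \<Longrightarrow> continuous_on A (\<lambda>x. logistic (f x))"
  unfolding logistic_def by (intro continuous_intros) auto

lemma logistic_measurable [measurable]: "logistic \<in> borel_measurable borel"
  by (intro borel_measurable_continuous_onI continuous_intros)

lemma logistic_at_top: "(logistic \<longlongrightarrow> 1) at_top"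
  unfolding logistic_def by real_asymp

lemma inj_logistic: "inj logistic"
  by (auto simp: inj_def logistic_def)

lemma range_logistic: "range logistic = {0<..<1}"
proof (intro equalityI subsetI)
  fix t :: real assume t: "t \<in> {0<..<1}"
  then have "logistic (ln (t / (1 - t))) = t"
    by (simp add: logistic_def exp_minus field_simps)
  then show "t \<in> range logistic" by (metis rangeI)
qed auto

lemma has_bochner_integral_Beta_logistic_real:
  assumes "p > 0" "q > 0"
  shows "has_bochner_integral lborel (\<lambda>u. logistic u powr p * (1 - logistic u) powr q) (Beta p q)"
proof -
  define f where "f = (\<lambda>t::real. t powr (p - 1) * (1 - t) powr (q - 1))"
  have f: "(f has_integral Beta p q) {0<..<1}"
    using has_integral_Beta_real[OF assms] by (simp add: f_def has_integral_Icc_iff_Ioo)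
  then have "f absolutely_integrable_on {0<..<1}"
    by (intro nonnegative_absolutely_integrable_1) (auto simp: f_def has_integral_iff)
  then have "f absolutely_integrable_on logistic ` UNIV \<and> integral (logistic ` UNIV) f = Beta p q"
    using f by (simp add: range_logistic has_integral_iff)
  then have "(\<lambda>u. \<bar>logistic u * (1 - logistic u)\<bar> * f (logistic u)) absolutely_integrable_on UNIV \<and>
     integral UNIV (\<lambda>u. \<bar>logistic u * (1 - logistic u)\<bar> * f (logistic u)) = Beta p q"
    by (subst has_absolute_integral_change_of_variables_1')
       (use inj_logistic logistic_deriv in auto)
  moreover have "\<bar>logistic u * (1 - logistic u)\<bar> * f (logistic u) = logistic u powr p * (1 - logistic u) powr q" for u
    by (simp add: f_def powr_diff)
  ultimately have *: "(\<lambda>u. logistic u powr p * (1 - logistic u) powr q) absolutely_integrable_on UNIV"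
     "integral UNIV (\<lambda>u. logistic u powr p * (1 - logistic u) powr q) = Beta p q" by auto
  have "integrable lborel (\<lambda>u. logistic u powr p * (1 - logistic u) powr q)"
    using *(1) unfolding set_integrable_def by (subst (asm) integrable_completion) auto
  with *(2) show ?thesis
    by (simp add: has_bochner_integral_iff integral_lborel[symmetric])
qed

text \<open>The integrand of Euler's Beta integral in the variable u. The Jacobian dt = t(1 - t) du
  has absorbed the -1 in both exponents, so products of kernels simply add their parameters.\<close>

definition beta_kernel :: "complex \<Rightarrow> complex \<Rightarrow> real \<Rightarrow> complex" where
  "beta_kernel p q u = of_real (logistic u) powr p * of_real (1 - logistic u) powr q"

lemma norm_beta_kernel:
  "norm (beta_kernel p q u) = logistic u powr Re p * (1 - logistic u) powr Re q"
  by (simp add: beta_kernel_def norm_mult norm_powr_real_powr)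

lemma beta_kernel_measurable [measurable]: "beta_kernel p q \<in> borel_measurable borel"
  unfolding beta_kernel_def by measurable

lemma beta_kernel_holomorphic1: "(\<lambda>p. beta_kernel p q u) holomorphic_on A"
  unfolding beta_kernel_def by (intro holomorphic_intros)

lemma beta_kernel_commute: "beta_kernel p q (- u) = beta_kernel q p u"
proof -
  have "logistic (- u) = 1 - logistic u"
    by (simp add: logistic_def exp_minus field_simps)
  then show ?thesis by (simp add: beta_kernel_def)
qed

lemma integrable_beta_kernel:
  assumes "Re p > 0" "Re q > 0"
  shows "integrable lborel (beta_kernel p q)"
  by (rule Bochner_Integration.integrable_bound
        [OF integrable.intros[OF has_bochner_integral_Beta_logistic_real[OF assms]]])
     (auto simp: norm_beta_kernel)

lemma integral_beta_kernel_commute: "(\<integral>u. beta_kernel p q u \<partial>lborel) = (\<integral>u. beta_kernel q p u \<partial>lborel)"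
  by (subst lborel_integral_real_affine[of "-1" _ 0]) (simp_all add: beta_kernel_commute)

lemma integral_beta_kernel_holomorphic:
  assumes "Re q > 0"
  shows "(\<lambda>p. \<integral>u. beta_kernel p q u \<partial>lborel) holomorphic_on {p. Re p > 0}"
proof (rule holomorphic_on_integral)
  show "open {p. 0 < Re p}" by (rule open_halfspace_Re_gt)
  fix z0 assume z0: "z0 \<in> {p. 0 < Re p}"
  show "\<exists>r>0. \<exists>h. cball z0 r \<subseteq> {p. 0 < Re p} \<and> integrable lborel h \<and>
             (\<forall>z\<in>cball z0 r. \<forall>u. norm (beta_kernel z q u) \<le> h u)"
  proof (intro exI conjI ballI allI)
    \<comment> \<open>On this disc Re z is at least half of Re z0. As the base
      \<open>logistic u\<close> is below 1, the kernel with the smaller exponent z0/2 is a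
      majorant.\<close>
    show "0 < Re z0 / 2" using z0 by simp
    show "integrable lborel (\<lambda>u. norm (beta_kernel (z0 / 2) q u))"
      using z0 assms by (intro integrable_norm integrable_beta_kernel) auto
    have Re: "Re z \<ge> Re z0 / 2" if "z \<in> cball z0 (Re z0 / 2)" for z
      using that abs_Re_le_cmod[of "z0 - z"] by (auto simp: dist_norm)
    show "cball z0 (Re z0 / 2) \<subseteq> {p. 0 < Re p}" using Re z0 by fastforce
    show "norm (beta_kernel z q u) \<le> norm (beta_kernel (z0 / 2) q u)" if "z \<in> cball z0 (Re z0 / 2)" for z u
      unfolding norm_beta_kernel using Re[OF that] by (intro mult_right_mono powr_mono') auto
  qed
qed (auto intro: beta_kernel_holomorphic1)

lemma Beta_holomorphic1:
  assumes "Re q > 0"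
  shows "(\<lambda>p. Beta p q) holomorphic_on {p. Re p > 0}"
  using assms by (intro holomorphic_intros) (auto elim!: nonpos_Ints_cases)

text \<open>Starting from real exponents, the identity theorem is applied in the first exponent
  while the second is real. The reflection u \<mapsto> -u interchanges the exponents, and a second
  continuation makes both complex.\<close>

lemma integral_beta_kernel:
  assumes p: "Re p > 0" and q: "Re q > 0"
  shows "(\<integral>u. beta_kernel p q u \<partial>lborel) = Beta p q"
proof -
  have hp: "open {p. 0 < Re p}" "connected {p. 0 < Re p}"
    by (auto simp: open_halfspace_Re_gt intro: convex_connected convex_halfspace_Re_gt)
  have real: "(\<integral>u. beta_kernel (of_real p) (of_real q) u \<partial>lborel) = Beta (of_real p) (of_real q)"
    if "p > 0" "q > 0" for p q
  proof -
    have "beta_kernel (of_real p) (of_real q) u = of_real (logistic u powr p * (1 - logistic u) powr q)" for u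
      by (simp add: beta_kernel_def powr_of_real[symmetric])
    with has_bochner_integral_integral_eq[OF has_bochner_integral_Beta_logistic_real[OF that]]
    show ?thesis by (simp add: Beta_complex_of_real del: of_real_mult)
  qed
  have "(\<integral>u. beta_kernel p (of_real q) u \<partial>lborel) = Beta p (of_real q)" if "Re p > 0" "q > 0" for p q
    by (rule holomorphic_eq_from_real_interval
          [OF integral_beta_kernel_holomorphic Beta_holomorphic1 hp, where x = 1 and y = 2])
       (use that real in auto)
  then have "(\<integral>u. beta_kernel q (of_real t) u \<partial>lborel) = Beta q (of_real t)" if "t > 0" for t
    using that q by blast
  then have "(\<integral>u. beta_kernel (of_real t) q u \<partial>lborel) = Beta (of_real t) q" if "t > 0" for t
    using that by (subst integral_beta_kernel_commute, subst Beta_commute)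
  note real' = this
  show ?thesis
    by (rule holomorphic_eq_from_real_interval
          [OF integral_beta_kernel_holomorphic Beta_holomorphic1 hp, where x = 1 and y = 2])
       (use p q real' in auto)
qed

section \<open>Euler's integral on the cut plane\<close>

definition cut_plane :: "complex set" where
  "cut_plane = - complex_of_real ` {1..}"

lemma cut_plane_altdef: "cut_plane = - {z. Im z = 0 \<and> Re z \<ge> 1}"
proof -
  have "complex_of_real ` {1..} = {z. Im z = 0 \<and> Re z \<ge> 1}"
    by (force simp: complex_eq_iff image_iff)
  then show ?thesis by (simp add: cut_plane_def)
qed

lemma open_cut_plane: "open cut_plane"
proof -
  have "closed ({z. Im z = 0} \<inter> {z. Re z \<ge> 1})"
    by (intro closed_Int closed_halfspace_Re_ge closed_Collect_eq continuous_intros)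
  then show ?thesis
    unfolding cut_plane_altdef Collect_conj_eq by (rule open_Compl)
qed

lemma connected_cut_plane: "connected cut_plane"
proof -
  have "starlike cut_plane"
    unfolding starlike_def
  proof (intro bexI ballI subsetI)
    show "(0 :: complex) \<in> cut_plane" by (simp add: cut_plane_altdef)
    fix z w assume z: "z \<in> cut_plane" and "w \<in> closed_segment 0 z"
    then obtain t where t: "0 \<le> t" "t \<le> 1" "w = of_real t * z"
      by (auto simp: closed_segment_def scaleR_conv_of_real)
    show "w \<in> cut_plane"
    proof (rule ccontr)
      assume "w \<notin> cut_plane"
      then have w: "t * Im z = 0" "t * Re z \<ge> 1" using t by (auto simp: cut_plane_altdef)
      then have "t \<noteq> 0" by auto
      then have "Im z = 0" "t > 0" using w t by auto
      moreover have "Re z \<ge> 1"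
      proof (rule ccontr)
        assume "\<not> Re z \<ge> 1"
        then have "t * Re z < t * 1" using \<open>t > 0\<close> by (intro mult_strict_left_mono) auto
        then show False using w t by simp
      qed
      ultimately show False using z by (simp add: cut_plane_altdef)
    qed
  qed
  then show ?thesis by (rule starlike_imp_connected)
qed

lemma ball_0_1_subset_cut_plane: "ball 0 1 \<subseteq> cut_plane"
proof
  fix z :: complex assume "z \<in> ball 0 1"
  then have "\<bar>Re z\<bar> < 1" using abs_Re_le_cmod[of z] by auto
  then show "z \<in> cut_plane" by (auto simp: cut_plane_altdef)
qed

text \<open>\<open>hypergeo_cont\<close> is a choice, so exhibiting one admissible \<open>f\<close>
  gives existence, and the connectedness of the cut plane makes the chosen function agree with
  it.\<close>

lemma hypergeo_cont_eq:
  assumes hol: "f holomorphic_on cut_plane"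
    and eq: "\<And>z. norm z < 1 \<Longrightarrow> f z = hypergeo_series as bs z"
    and z: "z \<in> cut_plane"
  shows "hypergeo_cont as bs z = f z"
proof -
  define P where
    "P = (\<lambda>f. f holomorphic_on cut_plane \<and> (\<forall>z. norm z < 1 \<longrightarrow> f z = hypergeo_series as bs z))"
  have "P f" using hol eq by (simp add: P_def)
  then have "P (Eps P)" by (rule someI[of P f])
  also have "Eps P = hypergeo_cont as bs"
    by (simp add: hypergeo_cont_def P_def cut_plane_def)
  finally have hol': "hypergeo_cont as bs holomorphic_on cut_plane"
    and eq': "\<And>z. norm z < 1 \<Longrightarrow> hypergeo_cont as bs z = hypergeo_series as bs z"
    by (auto simp: P_def)
  show ?thesis
    by (rule analytic_continuation_open[of "ball 0 1" cut_plane "hypergeo_cont as bs" f])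
       (use hol hol' eq eq' z open_cut_plane connected_cut_plane ball_0_1_subset_cut_plane in auto)
qed

text \<open>The cut plane is star-shaped about 0, so z t never reaches the cut. Hence the principal
  power in Euler's integrand stays away from its branch cut for every z that matters.\<close>

lemma one_minus_mult_notin_nonpos_Reals:
  assumes z: "z \<in> cut_plane" and t: "0 \<le> t" "t \<le> 1"
  shows "1 - z * of_real t \<notin> \<real>\<^sub>\<le>\<^sub>0"
proof
  assume "1 - z * of_real t \<in> \<real>\<^sub>\<le>\<^sub>0"
  then have *: "Re z * t \<ge> 1" "Im z * t = 0"
    by (auto simp: complex_nonpos_Reals_iff)
  then have "t \<noteq> 0" by auto
  then have "Im z = 0" "t > 0" using * t by auto
  moreover have "Re z \<ge> 1"
  proof (rule ccontr)
    assume "\<not> Re z \<ge> 1"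
    then have "Re z * t < 1 * t" using \<open>t > 0\<close> by (intro mult_strict_right_mono) auto
    then show False using * t by simp
  qed
  ultimately show False using z by (simp add: cut_plane_altdef)
qed

text \<open>Continuity is needed jointly in z and t: on a compact set of z it gives one bound for
  all t, the majorant for holomorphy of Euler's integral.\<close>

lemma continuous_on_one_minus_mult_powr:
  assumes "K \<subseteq> cut_plane"
  shows "continuous_on (K \<times> {0..1}) (\<lambda>(z, t). (1 - z * of_real t) powr e)"
  unfolding case_prod_unfold
proof (intro continuous_intros)
  have *: "1 - fst p * of_real (snd p) \<notin> \<real>\<^sub>\<le>\<^sub>0" if "p \<in> K \<times> {0..1}" for p :: "complex \<times> real"
    by (rule one_minus_mult_notin_nonpos_Reals) (use that assms in auto)
  show "K \<times> {0..1} \<subseteq> {p. 0 \<le> Re (1 - fst p * of_real (snd p)) \<or> Im (1 - fst p * of_real (snd p)) \<noteq> 0}"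
  proof
    fix p assume "p \<in> K \<times> {0..1::real}"
    from *[OF this] show "p \<in> {p. 0 \<le> Re (1 - fst p * of_real (snd p)) \<or> Im (1 - fst p * of_real (snd p)) \<noteq> 0}"
      unfolding complex_nonpos_Reals_iff mem_Collect_eq by linarith
  qed
  show "0 < Re e" if "p \<in> K \<times> {0..1}" "1 - fst p * of_real (snd p) = 0" for p
    using *[OF that(1)] that(2) by simp
qed

lemma continuous_on_one_minus_mult_powr':
  assumes "z \<in> cut_plane"
  shows "continuous_on {0..1} (\<lambda>t. (1 - z * of_real t) powr e)"
proof -
  have "continuous_on {0..1} ((\<lambda>(z, t). (1 - z * of_real t) powr e) \<circ> (\<lambda>t. (z, t)))"
    by (intro continuous_on_compose continuous_intros
              continuous_on_subset[OF continuous_on_one_minus_mult_powr[of "{z}"]])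
       (use assms in auto)
  then show ?thesis by (simp add: o_def)
qed

lemma continuous_on_logistic_compose:
  fixes h :: "real \<Rightarrow> complex"
  assumes "continuous_on {0..1} h"
  shows "continuous_on A (\<lambda>u. h (logistic u))"
  by (rule continuous_on_compose2[OF assms]) (auto intro!: continuous_intros)

lemma bounded_on_unit_interval:
  fixes h :: "real \<Rightarrow> complex"
  assumes "continuous_on {0..1} h"
  shows "\<exists>M. \<forall>t\<in>{0..1}. norm (h t) \<le> M"
proof -
  have "bounded (h ` {0..1})"
    using assms by (intro compact_imp_bounded compact_continuous_image) auto
  then show ?thesis by (auto simp: bounded_iff)
qed

lemma continuous_on_beta_kernel: "continuous_on A (beta_kernel p q)"
  unfolding beta_kernel_def
  by (intro continuous_intros) (auto simp: less_imp_le)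

lemma integrable_beta_kernel_mult:
  assumes pq: "Re p > 0" "Re q > 0" and h: "continuous_on {0..1} h"
  shows "integrable lborel (\<lambda>u. beta_kernel p q u * h (logistic u))"
proof -
  obtain M where M: "\<And>t. t \<in> {0..1} \<Longrightarrow> norm (h t) \<le> M"
    using bounded_on_unit_interval[OF h] by blast
  show ?thesis
  proof (rule Bochner_Integration.integrable_bound)
    show "integrable lborel (\<lambda>u. beta_kernel p q u * of_real M)"
      by (intro integrable_mult_left integrable_beta_kernel pq)
    have [measurable]: "(\<lambda>u. h (logistic u)) \<in> borel_measurable borel"
      by (intro borel_measurable_continuous_onI continuous_on_logistic_compose h)
    show "(\<lambda>u. beta_kernel p q u * h (logistic u)) \<in> borel_measurable lborel"
      by measurable
    have "norm (h (logistic u)) \<le> \<bar>M\<bar>" for u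
      by (rule order_trans[OF M abs_ge_self]) auto
    then show "AE u in lborel. norm (beta_kernel p q u * h (logistic u)) \<le> norm (beta_kernel p q u * of_real M)"
      by (intro AE_I2) (auto simp: norm_mult intro!: mult_left_mono)
  qed
qed

text \<open>Euler's integral for Beta(p, q) 2F1(-e, p; p + q; z), meaningful on the whole cut plane
  and thus a concrete analytic continuation of the series.\<close>

definition euler_integral :: "complex \<Rightarrow> complex \<Rightarrow> complex \<Rightarrow> complex \<Rightarrow> complex" where
  "euler_integral p q e z = (\<integral>u. beta_kernel p q u * (1 - z * of_real (logistic u)) powr e \<partial>lborel)"

lemma euler_integral_holomorphic:
  assumes pq: "Re p > 0" "Re q > 0"
  shows "euler_integral p q e holomorphic_on cut_plane"
  unfolding euler_integral_def
proof (rule holomorphic_on_integral)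
  fix z assume "z \<in> cut_plane"
  then have "integrable lborel (\<lambda>u. beta_kernel p q u * (1 - z * of_real (logistic u)) powr e)"
    by (intro integrable_beta_kernel_mult continuous_on_one_minus_mult_powr' pq)
  then show "(\<lambda>u. beta_kernel p q u * (1 - z * of_real (logistic u)) powr e) \<in> borel_measurable lborel"
    by auto
next
  show "(\<lambda>z. beta_kernel p q u * (1 - z * of_real (logistic u)) powr e) holomorphic_on cut_plane" for u
    by (intro holomorphic_intros one_minus_mult_notin_nonpos_Reals) auto
next
  fix z0 assume "z0 \<in> cut_plane"
  then obtain r where r: "r > 0" "cball z0 r \<subseteq> cut_plane"
    using open_cut_plane open_contains_cball by blast
  have "bounded ((\<lambda>(z, t). (1 - z * of_real t) powr e) ` (cball z0 r \<times> {0..1}))"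
    by (intro compact_imp_bounded compact_continuous_image continuous_on_one_minus_mult_powr r compact_Times) auto
  then obtain M where "\<forall>y\<in>(\<lambda>(z, t). (1 - z * of_real t) powr e) ` (cball z0 r \<times> {0..1}). norm y \<le> M"
    unfolding bounded_iff by blast
  then have M: "norm ((1 - z * of_real t) powr e) \<le> M" if "z \<in> cball z0 r" "0 \<le> t" "t \<le> 1" for z t
    using that by auto
  show "\<exists>r>0. \<exists>h. cball z0 r \<subseteq> cut_plane \<and> integrable lborel h \<and>
     (\<forall>z\<in>cball z0 r. \<forall>u. norm (beta_kernel p q u * (1 - z * of_real (logistic u)) powr e) \<le> h u)"
  proof (intro exI conjI ballI allI)
    show "integrable lborel (\<lambda>u. norm (beta_kernel p q u) * M)"
      by (intro integrable_mult_left integrable_norm integrable_beta_kernel pq)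
    show "norm (beta_kernel p q u * (1 - z * of_real (logistic u)) powr e) \<le> norm (beta_kernel p q u) * M"
      if "z \<in> cball z0 r" for z u
      unfolding norm_mult by (intro mult_left_mono M that) auto
  qed (use r in auto)
qed (rule open_cut_plane)

lemma binomial_series_pochhammer:
  fixes w a :: complex
  assumes "norm w < 1"
  shows "(\<lambda>n. pochhammer a n / fact n * w ^ n) sums (1 - w) powr (- a)"
proof -
  have "(\<lambda>n. (- a gchoose n) * (- w) ^ n) sums (1 + (- w)) powr (- a)"
    using assms by (intro gen_binomial_complex) auto
  moreover have "(- a gchoose n) * (- w) ^ n = pochhammer a n / fact n * w ^ n" for n
    by (simp add: gbinomial_pochhammer power_minus[of w] field_simps)
  ultimately show ?thesis by simp
qed

lemma summable_norm_binomial_series: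
  fixes a :: complex
  assumes "0 \<le> r" "r < 1"
  shows "summable (\<lambda>n. norm (pochhammer a n / fact n) * r ^ n)"
proof -
  define x where "x = complex_of_real ((1 + r) / 2)"
  have x: "norm x = (1 + r) / 2" using assms by (simp add: x_def norm_divide flip: of_real_add)
  have "summable (\<lambda>n. norm (pochhammer a n / fact n * of_real r ^ n))"
    by (rule powser_insidea[OF sums_summable[OF binomial_series_pochhammer[of x]]])
       (use assms x in auto)
  then show ?thesis using assms by (simp add: norm_mult norm_power norm_divide)
qed

lemma beta_kernel_mult_power:
  "beta_kernel p q u * of_real (logistic u) ^ n = beta_kernel (p + of_nat n) q u"
  by (simp add: beta_kernel_def powr_add powr_nat')

lemma Re_pos_not_nonpos_Int: "Re z > 0 \<Longrightarrow> z \<notin> \<int>\<^sub>\<le>\<^sub>0"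
  by (auto elim!: nonpos_Ints_cases)

lemma Beta_Re_pos_nonzero:
  fixes p q :: complex
  assumes "Re p > 0" "Re q > 0"
  shows "Beta p q \<noteq> 0"
  using assms Re_pos_not_nonpos_Int[of p] Re_pos_not_nonpos_Int[of q] Re_pos_not_nonpos_Int[of "p + q"]
  by (simp add: Beta_def Gamma_eq_zero_iff)

lemma Beta_plus_of_nat:
  fixes p q :: complex
  assumes "Re p > 0" "Re q > 0"
  shows "Beta (p + of_nat n) q = Beta p q * pochhammer p n / pochhammer (p + q) n"
proof -
  have "p \<notin> \<int>\<^sub>\<le>\<^sub>0" "p + q \<notin> \<int>\<^sub>\<le>\<^sub>0" using assms by (intro Re_pos_not_nonpos_Int; simp)+
  moreover from this have "Gamma p \<noteq> 0" "Gamma (p + q) \<noteq> 0" by (auto simp: Gamma_eq_zero_iff)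
  ultimately show ?thesis
    by (simp add: Beta_def pochhammer_Gamma add_ac)
qed

text \<open>Termwise integration of the binomial series. Since \<open>logistic u\<close> lies
  between 0 and 1, the series at |z| dominates, and the n-th power of \<open>logistic u\<close>
  merely shifts p to p + n.\<close>

lemma euler_integral_series:
  assumes pq: "Re p > 0" "Re q > 0" and z: "norm z < 1"
  shows "euler_integral p q (- a) z = Beta p q * (\<Sum>n. pochhammer a n * pochhammer p n / pochhammer (p + q) n * (z ^ n / fact n))"
proof -
  define f where "f = (\<lambda>n u. (pochhammer a n / fact n * z ^ n) * beta_kernel (p + of_nat n) q u)"
  have f_eq: "f n u = beta_kernel p q u * (pochhammer a n / fact n * (z * of_real (logistic u)) ^ n)" for n u
    by (simp add: f_def beta_kernel_mult_power[symmetric] power_mult_distrib)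
  have le: "norm (f n u) \<le> norm (pochhammer a n / fact n) * norm z ^ n * norm (beta_kernel p q u)" for n u
  proof -
    have "norm (of_real (logistic u) :: complex) ^ n \<le> 1"
      by (simp add: power_le_one)
    then have "norm (pochhammer a n / fact n) * norm z ^ n * norm (beta_kernel p q u) * norm (of_real (logistic u) :: complex) ^ n
      \<le> norm (pochhammer a n / fact n) * norm z ^ n * norm (beta_kernel p q u) * 1"
      by (intro mult_left_mono) auto
    then show ?thesis by (simp add: f_eq norm_mult norm_power norm_divide power_mult_distrib mult_ac)
  qed
  have bk: "integrable lborel (beta_kernel (p + of_nat n) q)" for n
    using pq by (intro integrable_beta_kernel) auto
  have f: "integrable lborel (f n)" for n
    unfolding f_def by (intro integrable_mult_right bk)
  have sm: "summable (\<lambda>n. norm (pochhammer a n / fact n) * norm z ^ n * c)" for c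
    using z by (intro summable_mult2 summable_norm_binomial_series) auto
  have "(\<lambda>n. \<integral>u. f n u \<partial>lborel) sums (\<integral>u. (\<Sum>n. f n u) \<partial>lborel)"
  proof (rule sums_integral[OF f])
    show "AE u in lborel. summable (\<lambda>n. norm (f n u))"
      by (intro AE_I2 summable_comparison_test'[OF sm]) (use le in auto)
    show "summable (\<lambda>n. \<integral>u. norm (f n u) \<partial>lborel)"
    proof (rule summable_comparison_test'[OF sm])
      fix n
      have "(\<integral>u. norm (f n u) \<partial>lborel) \<le> (\<integral>u. norm (pochhammer a n / fact n) * norm z ^ n * norm (beta_kernel p q u) \<partial>lborel)"
        using integrable_beta_kernel[OF pq] by (intro integral_mono le integrable_norm f integrable_mult_right)
      also have "\<dots> = norm (pochhammer a n / fact n) * norm z ^ n * (\<integral>u. norm (beta_kernel p q u) \<partial>lborel)"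
        by simp
      finally show "norm (\<integral>u. norm (f n u) \<partial>lborel) \<le> norm (pochhammer a n / fact n) * norm z ^ n * (\<integral>u. norm (beta_kernel p q u) \<partial>lborel)"
        by simp
    qed
  qed
  moreover have "(\<Sum>n. f n u) = beta_kernel p q u * (1 - z * of_real (logistic u)) powr (- a)" for u
  proof -
    have "norm (z * of_real (logistic u)) < 1"
      using z mult_left_le[of "logistic u" "norm z"] by (simp add: norm_mult)
    from sums_mult[OF binomial_series_pochhammer[OF this, of a], of "beta_kernel p q u"]
    show ?thesis by (simp add: f_eq sums_iff)
  qed
  moreover have "(\<integral>u. f n u \<partial>lborel) = Beta p q * (pochhammer a n * pochhammer p n / pochhammer (p + q) n * (z ^ n / fact n))" for n
    unfolding f_def using pq by (simp add: integral_beta_kernel Beta_plus_of_nat mult_ac)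
  ultimately have *: "(\<lambda>n. Beta p q * (pochhammer a n * pochhammer p n / pochhammer (p + q) n * (z ^ n / fact n)))
     sums euler_integral p q (- a) z"
    by (simp add: euler_integral_def)
  have "Beta p q \<noteq> 0"
    by (rule Beta_Re_pos_nonzero[OF pq])
  with sums_divide[OF *, of "Beta p q"]
  have "(\<lambda>n. pochhammer a n * pochhammer p n / pochhammer (p + q) n * (z ^ n / fact n))
      sums (euler_integral p q (- a) z / Beta p q)"
    by (simp only: nonzero_mult_div_cancel_left not_False_eq_True)
  from sums_unique[OF this, symmetric] \<open>Beta p q \<noteq> 0\<close> show ?thesis
    by (simp only: nonzero_mult_div_cancel_left times_divide_eq_right not_False_eq_True)
qed

text \<open>The common parameter s cancels in every term of the 3F2. It will be Re a + Re b = a +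
  cnj b, which is where the equality of the imaginary parts of a and b is used.\<close>

lemma Beta_mult_hypergeo_cont:
  assumes pq: "Re p > 0" "Re q > 0" and s: "Re s > 0" and z: "z \<in> cut_plane"
  shows "Beta p q * hypergeo_cont [a, s, p] [p + q, s] z = euler_integral p q (- a) z"
proof -
  have nz: "Beta p q \<noteq> 0"
    by (rule Beta_Re_pos_nonzero[OF pq])
  have series: "euler_integral p q (- a) w / Beta p q = hypergeo_series [a, s, p] [p + q, s] w" if "norm w < 1" for w
  proof -
    have "hypergeo_series [a, s, p] [p + q, s] w =
      (\<Sum>n. pochhammer a n * pochhammer p n / pochhammer (p + q) n * (w ^ n / fact n))"
      unfolding hypergeo_series_def using pochhammer_Re_pos_nonzero[OF s]
      by (intro suminf_cong) simp
    then show ?thesis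
      unfolding euler_integral_series[OF pq that] using nz by (simp only: nonzero_mult_div_cancel_left not_False_eq_True)
  qed
  have "hypergeo_cont [a, s, p] [p + q, s] z = euler_integral p q (- a) z / Beta p q"
    by (rule hypergeo_cont_eq[of "\<lambda>z. euler_integral p q (- a) z / Beta p q"])
       (intro holomorphic_intros euler_integral_holomorphic[OF pq] nz series z | assumption)+
  with nz show ?thesis by simp
qed

section \<open>Integration by parts\<close>

lemma integral_derivative_eq_0:
  fixes F f :: "real \<Rightarrow> complex"
  assumes der: "\<And>x. (F has_vector_derivative f x) (at x)"
    and cont: "continuous_on UNIV f" and int: "integrable lborel f"
    and lim: "(F \<longlongrightarrow> 0) at_top" "(F \<longlongrightarrow> 0) at_bot"
  shows "(\<integral>x. f x \<partial>lborel) = 0"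
proof -
  have "(LBINT x=-\<infinity>..\<infinity>. f x) = 0 - 0"
  proof (rule interval_integral_FTC_integrable)
    show "isCont f x" for x
      using cont by (simp add: continuous_on_eq_continuous_at)
    show "set_integrable lborel (einterval (- \<infinity>) \<infinity>) f"
      using int by (simp add: set_integrable_def)
  qed (use der lim in \<open>auto simp: ereal_tendsto_simps\<close>)
  then show ?thesis
    by (simp add: interval_lebesgue_integral_def set_lebesgue_integral_def)
qed

lemma beta_kernel_at_top:
  assumes "Re q > 0"
  shows "(beta_kernel p q \<longlongrightarrow> 0) at_top"
proof (rule tendsto_norm_zero_cancel)
  have "((\<lambda>u. logistic u powr Re p * (1 - logistic u) powr Re q) \<longlongrightarrow> 1 powr Re p * (1 - 1) powr Re q) at_top"
    using assms by (intro tendsto_intros logistic_at_top) auto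
  then show "((\<lambda>u. norm (beta_kernel p q u)) \<longlongrightarrow> 0) at_top"
    using assms by (simp add: norm_beta_kernel)
qed

lemma beta_kernel_at_bot:
  assumes "Re p > 0"
  shows "(beta_kernel p q \<longlongrightarrow> 0) at_bot"
  unfolding filterlim_at_bot_mirror beta_kernel_commute
  using assms by (rule beta_kernel_at_top)

lemma beta_kernel_deriv:
  "(beta_kernel p q has_vector_derivative
     beta_kernel p q u * (p * (1 - of_real (logistic u)) - q * of_real (logistic u))) (at u)"
proof -
  \<comment> \<open>With real logarithms in the exponent, the chain rule for exp handles the complex
    powers; the two logarithmic derivatives are 1 - \<open>logistic u\<close> and
    -\<open>logistic u\<close>.\<close>
  define E where "E = (\<lambda>u. p * of_real (ln (logistic u)) + q * of_real (ln (1 - logistic u)))"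
  have bk: "beta_kernel p q = exp \<circ> E"
  proof
    fix u
    have "Ln (complex_of_real (logistic u)) = of_real (ln (logistic u))"
      by (rule Ln_of_real) simp
    moreover have "Ln (complex_of_real (1 - logistic u)) = of_real (ln (1 - logistic u))"
      by (rule Ln_of_real) simp
    moreover have "complex_of_real (logistic u) \<noteq> 0" "complex_of_real (1 - logistic u) \<noteq> 0"
      by (simp_all only: of_real_eq_0_iff logistic_nonzero not_False_eq_True)
    ultimately show "beta_kernel p q u = (exp \<circ> E) u"
      by (simp only: beta_kernel_def powr_def E_def o_def exp_add if_False)
  qed
  have "((\<lambda>u. ln (logistic u)) has_real_derivative 1 - logistic u) (at u)"
    by (auto intro!: derivative_eq_intros logistic_deriv)
  note d1 = has_vector_derivative_mult_right[OF has_vector_derivative_of_real[OF this], of p]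
  have "((\<lambda>u. ln (1 - logistic u)) has_real_derivative - logistic u) (at u)"
    by (auto intro!: derivative_eq_intros logistic_deriv)
  note d2 = has_vector_derivative_mult_right[OF has_vector_derivative_of_real[OF this], of q]
  have "(E has_vector_derivative p * (1 - of_real (logistic u)) - q * of_real (logistic u)) (at u)"
    unfolding E_def using has_vector_derivative_add[OF d1 d2] by simp
  from field_vector_diff_chain_at[OF this DERIV_exp]
  show ?thesis
    unfolding bk by (simp add: mult.commute)
qed

text \<open>The integrand is the derivative of \<open>beta_kernel p q u * G (logistic u)\<close>,
  which tends to 0 at both ends because the kernel does and \<open>G\<close> is bounded.\<close>

lemma integral_beta_kernel_by_parts:
  assumes pq: "Re p > 0" "Re q > 0"
    and der: "\<And>t. t \<in> {0<..<1} \<Longrightarrow> (G has_vector_derivative G' t) (at t)"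
    and G: "continuous_on {0..1} G" and G': "continuous_on {0..1} G'"
  shows "(\<integral>u. beta_kernel p q u * ((p * (1 - of_real (logistic u)) - q * of_real (logistic u)) * G (logistic u) +
            of_real (logistic u) * (1 - of_real (logistic u)) * G' (logistic u)) \<partial>lborel) = 0"
proof (rule integral_derivative_eq_0)
  have h: "continuous_on {0..1} (\<lambda>t. (p * (1 - of_real t) - q * of_real t) * G t + of_real t * (1 - of_real t) * G' t)"
    by (intro continuous_intros G G')
  show "integrable lborel (\<lambda>u. beta_kernel p q u * ((p * (1 - of_real (logistic u)) - q * of_real (logistic u)) * G (logistic u) +
            of_real (logistic u) * (1 - of_real (logistic u)) * G' (logistic u)))"
    by (rule integrable_beta_kernel_mult[OF pq h])
  show "continuous_on UNIV (\<lambda>u. beta_kernel p q u * ((p * (1 - of_real (logistic u)) - q * of_real (logistic u)) * G (logistic u) +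
            of_real (logistic u) * (1 - of_real (logistic u)) * G' (logistic u)))"
    by (intro continuous_on_mult continuous_on_beta_kernel continuous_on_logistic_compose[OF h])
  show "((\<lambda>u. beta_kernel p q u * G (logistic u)) has_vector_derivative
     beta_kernel p q u * ((p * (1 - of_real (logistic u)) - q * of_real (logistic u)) * G (logistic u) +
            of_real (logistic u) * (1 - of_real (logistic u)) * G' (logistic u))) (at u)" for u
  proof -
    have "((G \<circ> logistic) has_vector_derivative (logistic u * (1 - logistic u)) *\<^sub>R G' (logistic u)) (at u)"
      by (rule vector_diff_chain_at)
         (use logistic_deriv der in \<open>auto simp: has_real_derivative_iff_has_vector_derivative\<close>)
    from has_vector_derivative_mult[OF beta_kernel_deriv this]
    show ?thesis
      by (simp add: o_def scaleR_conv_of_real algebra_simps)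
  qed
  obtain M where M: "\<And>t. t \<in> {0..1} \<Longrightarrow> norm (G t) \<le> M"
    using bounded_on_unit_interval[OF G] by blast
  have "((\<lambda>u. beta_kernel p q u * G (logistic u)) \<longlongrightarrow> 0) F" if "(beta_kernel p q \<longlongrightarrow> 0) F" for F
    by (rule tendsto_0_le[OF that, of _ M])
       (use M in \<open>auto simp: norm_mult intro!: always_eventually mult_left_mono\<close>)
  then show "((\<lambda>u. beta_kernel p q u * G (logistic u)) \<longlongrightarrow> 0) at_top"
    "((\<lambda>u. beta_kernel p q u * G (logistic u)) \<longlongrightarrow> 0) at_bot"
    using pq by (auto intro: beta_kernel_at_top beta_kernel_at_bot)
qed

text \<open>Moments of y = 1 - 2t for the weight (t(1 - t))^(b - 1). They arise in the quadratic
  transformation, where the integrand is expanded in powers of y.\<close>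

definition symmetric_moment :: "complex \<Rightarrow> nat \<Rightarrow> complex" where
  "symmetric_moment b m = (\<integral>u. beta_kernel b b u * (1 - 2 * of_real (logistic u)) ^ m \<partial>lborel)"

lemma symmetric_moment_0: "Re b > 0 \<Longrightarrow> symmetric_moment b 0 = Beta b b"
  by (simp add: symmetric_moment_def integral_beta_kernel)

lemma symmetric_moment_1:
  assumes "Re b > 0"
  shows "symmetric_moment b (Suc 0) = 0"
proof -
  have "(\<integral>u. b * (beta_kernel b b u * (1 - 2 * of_real (logistic u))) \<partial>lborel) = 0"
    using integral_beta_kernel_by_parts[OF assms assms, of "\<lambda>_. 1" "\<lambda>_. 0"]
    by (simp add: algebra_simps)
  then show ?thesis
    using assms by (auto simp: symmetric_moment_def)
qed

text \<open>Integration by parts with G = y^(m + 1), using 4t(1 - t) = 1 - y^2.\<close>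

lemma symmetric_moment_Suc_Suc:
  assumes b: "Re b > 0"
  shows "(2 * b + of_nat (Suc m)) * symmetric_moment b (Suc (Suc m)) = of_nat (Suc m) * symmetric_moment b m"
proof -
  let ?y = "\<lambda>t. 1 - 2 * complex_of_real t"
  have int: "integrable lborel (\<lambda>u. beta_kernel b b u * ?y (logistic u) ^ n)" for n
    by (intro integrable_beta_kernel_mult[where h = "\<lambda>t. ?y t ^ n"] b continuous_intros)
  have der: "((\<lambda>t. ?y t ^ Suc m) has_vector_derivative - 2 * of_nat (Suc m) * ?y t ^ m) (at t)" for t
  proof -
    have "(?y has_vector_derivative - 2) (at t)"
      by (auto intro!: derivative_eq_intros)
    moreover have "((\<lambda>z. z ^ Suc m) has_field_derivative of_nat (Suc m) * z ^ m) (at z)" for z :: complex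
      using DERIV_power[OF DERIV_ident, where n = "Suc m"] by (simp del: power_Suc)
    ultimately have "((\<lambda>z. z ^ Suc m) \<circ> ?y has_vector_derivative - 2 * (of_nat (Suc m) * ?y t ^ m)) (at t)"
      by (rule field_vector_diff_chain_at)
    then show ?thesis by (simp only: o_def mult.assoc)
  qed
  have "0 = (\<integral>u. beta_kernel b b u * ((b * (1 - of_real (logistic u)) - b * of_real (logistic u)) * ?y (logistic u) ^ Suc m +
            of_real (logistic u) * (1 - of_real (logistic u)) * (- 2 * of_nat (Suc m) * ?y (logistic u) ^ m)) \<partial>lborel)"
    by (rule sym, rule integral_beta_kernel_by_parts[OF b b der]) (intro continuous_intros)+
  also have "\<dots> = (\<integral>u. (b + of_nat (Suc m) / 2) * (beta_kernel b b u * ?y (logistic u) ^ Suc (Suc m)) -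
        of_nat (Suc m) / 2 * (beta_kernel b b u * ?y (logistic u) ^ m) \<partial>lborel)"
    by (intro Bochner_Integration.integral_cong refl) (simp add: field_simps)
  also have "\<dots> = (b + of_nat (Suc m) / 2) * symmetric_moment b (Suc (Suc m)) - of_nat (Suc m) / 2 * symmetric_moment b m"
    unfolding symmetric_moment_def
    by (subst Bochner_Integration.integral_diff) (intro integrable_mult_right int | simp)+
  finally have *: "(b + of_nat (Suc m) / 2) * symmetric_moment b (Suc (Suc m)) - of_nat (Suc m) / 2 * symmetric_moment b m = 0" ..
  have "(2 * b + s) * X - s * Y = 2 * ((b + s / 2) * X - s / 2 * Y)" for s X Y
    by (simp add: algebra_simps)
  from this[of "of_nat (Suc m)" "symmetric_moment b (Suc (Suc m))" "symmetric_moment b m", unfolded *] show ?thesis by simp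
qed

lemma symmetric_moment_odd:
  assumes b: "Re b > 0" and "odd m"
  shows "symmetric_moment b m = 0"
proof -
  have "symmetric_moment b (Suc (2 * n)) = 0" for n
  proof (induction n)
    case (Suc n)
    have "2 * b + of_nat (Suc (Suc (2 * n))) \<noteq> 0"
      using b by (auto simp: complex_eq_iff)
    with symmetric_moment_Suc_Suc[OF b, of "Suc (2 * n)"] Suc show ?case by simp
  qed (simp add: symmetric_moment_1 b)
  with \<open>odd m\<close> show ?thesis by (auto elim!: oddE)
qed

lemma symmetric_moment_even:
  assumes b: "Re b > 0"
  shows "symmetric_moment b (2 * n) = Beta b b * pochhammer (1 / 2) n / pochhammer (b + 1 / 2) n"
proof (induction n)
  case (Suc n)
  have nz: "2 * b + of_nat (Suc (2 * n)) \<noteq> 0"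
    using b by (auto simp: complex_eq_iff)
  have "2 * (b + 1 / 2 + of_nat n) = 2 * b + of_nat (Suc (2 * n))"
    "2 * (1 / 2 + of_nat n) = (of_nat (Suc (2 * n)) :: complex)"
    by (simp_all add: algebra_simps)
  then have "symmetric_moment b (2 * Suc n) = (2 * (1 / 2 + of_nat n)) / (2 * (b + 1 / 2 + of_nat n)) * symmetric_moment b (2 * n)"
    using symmetric_moment_Suc_Suc[OF b, of "2 * n"] nz by (simp only: field_simps mult_Suc_right) (simp add: field_simps)
  then show ?case
    unfolding Suc pochhammer_rec' by (simp only: mult_divide_mult_cancel_left_if) (simp add: field_simps)
qed (simp add: symmetric_moment_0 b)

section \<open>Removing the Gegenbauer polynomial by repeated integration by parts\<close>

definition gegen_integral :: "nat \<Rightarrow> complex \<Rightarrow> complex \<Rightarrow> complex \<Rightarrow> complex" where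
  "gegen_integral k g e z = (\<integral>u. beta_kernel g g u *
     (poly (gegen_poly k g) (of_real (logistic u)) * (1 - z * of_real (logistic u)) powr e) \<partial>lborel)"

lemma gegen_integral_0: "gegen_integral 0 g e z = euler_integral g g e z"
  by (simp add: gegen_integral_def euler_integral_def)

text \<open>By \<open>gegen_poly_Suc\<close> the weight times the polynomial is a derivative. Moving
  it onto (1 - zt)^e gives the factor e z, and the remaining (t(1 - t))^g is the weight of parameter
  g + 1, so the integral keeps its shape.\<close>

lemma gegen_integral_Suc:
  assumes g: "Re g > 0" and z: "z \<in> cut_plane"
  shows "g * gegen_integral (Suc k) g e z = e * z * gegen_integral k (g + 1) (e - 1) z"
proof -
  define H where "H = gegen_poly k (g + 1)"
  let ?w = "\<lambda>t e. (1 - z * complex_of_real t) powr e"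
  let ?G = "\<lambda>t. poly H (of_real t) * ?w t e"
  let ?G' = "\<lambda>t. poly (pderiv H) (of_real t) * ?w t e - e * z * (poly H (of_real t) * ?w t (e - 1))"
  have g1: "Re (g + 1) > 0" using g by simp
  have cont: "continuous_on {0..1} (\<lambda>t. poly P (complex_of_real t) * ?w t e)" for P e
    by (intro continuous_intros continuous_on_one_minus_mult_powr' z)
  have der: "(?G has_vector_derivative ?G' t) (at t)" if t: "t \<in> {0<..<1}" for t
  proof -
    have "1 - z * complex_of_real t \<notin> \<real>\<^sub>\<le>\<^sub>0"
      using t by (intro one_minus_mult_notin_nonpos_Reals z) auto
    then have "((\<lambda>w. poly H w * (1 - z * w) powr e) has_field_derivative ?G' t) (at (of_real t))"
      by (auto intro!: derivative_eq_intros simp: algebra_simps)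
    then show ?thesis
      using has_vector_derivative_real_field[where f = "\<lambda>w. poly H w * (1 - z * w) powr e"] by simp
  qed
  have "0 = (\<integral>u. beta_kernel g g u * ((g * (1 - of_real (logistic u)) - g * of_real (logistic u)) * ?G (logistic u) +
            of_real (logistic u) * (1 - of_real (logistic u)) * ?G' (logistic u)) \<partial>lborel)"
    by (rule sym, rule integral_beta_kernel_by_parts[OF g g der])
       (auto intro!: continuous_intros continuous_on_one_minus_mult_powr' z)
  also have "\<dots> = (\<integral>u. g * (beta_kernel g g u * (poly (gegen_poly (Suc k) g) (of_real (logistic u)) * ?w (logistic u) e))
        - e * z * (beta_kernel (g + 1) (g + 1) u * (poly H (of_real (logistic u)) * ?w (logistic u) (e - 1))) \<partial>lborel)"
  proof (intro Bochner_Integration.integral_cong refl)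
    fix u
    define t where "t = complex_of_real (logistic u)"
    define B where "B = beta_kernel g g u"
    have B1: "beta_kernel (g + 1) (g + 1) u = B * (t * (1 - t))"
      by (simp add: B_def beta_kernel_def powr_add t_def)
    have *: "B * ((g * (1 - t) - g * t) * (poly H t * X) + t * (1 - t) * (poly (pderiv H) t * X - e * z * (poly H t * Y)))
       = g * (B * (poly (gegen_poly (Suc k) g) t * X)) - e * z * (B * (t * (1 - t)) * (poly H t * Y))" for X Y
    proof -
      have "B * ((g * (1 - t) - g * t) * (poly H t * X) + t * (1 - t) * (poly (pderiv H) t * X - e * z * (poly H t * Y)))
         = B * ((g * (1 - 2 * t) * poly H t + t * (1 - t) * poly (pderiv H) t) * X) - e * z * (B * (t * (1 - t)) * (poly H t * Y))"
        by (simp add: algebra_simps)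
      also have "g * (1 - 2 * t) * poly H t + t * (1 - t) * poly (pderiv H) t = g * poly (gegen_poly (Suc k) g) t"
        unfolding gegen_poly_Suc[OF g] H_def ..
      finally show ?thesis by (simp add: mult_ac)
    qed
    show "beta_kernel g g u * ((g * (1 - of_real (logistic u)) - g * of_real (logistic u)) * ?G (logistic u) +
            of_real (logistic u) * (1 - of_real (logistic u)) * ?G' (logistic u)) =
       g * (beta_kernel g g u * (poly (gegen_poly (Suc k) g) (of_real (logistic u)) * ?w (logistic u) e))
        - e * z * (beta_kernel (g + 1) (g + 1) u * (poly H (of_real (logistic u)) * ?w (logistic u) (e - 1)))"
      unfolding B1 unfolding t_def[symmetric] B_def[symmetric] by (rule *)
  qed
  also have "\<dots> = g * gegen_integral (Suc k) g e z - e * z * gegen_integral k (g + 1) (e - 1) z"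
    unfolding gegen_integral_def H_def[symmetric]
    by (subst Bochner_Integration.integral_diff)
       (intro integrable_mult_right integrable_beta_kernel_mult[OF g g] integrable_beta_kernel_mult[OF g1 g1] cont | simp)+
  finally show ?thesis by simp
qed

lemma gegen_integral_eq:
  assumes g: "Re g > 0" and z: "z \<in> cut_plane"
  shows "gegen_integral k g (- a) z =
    (- z) ^ k * pochhammer a k / pochhammer g k * euler_integral (g + of_nat k) (g + of_nat k) (- (a + of_nat k)) z"
  using g
proof (induction k arbitrary: g a)
  case 0
  then show ?case by (simp add: gegen_integral_0)
next
  case (Suc k)
  have "g \<noteq> 0" using Suc.prems by auto
  have "g * gegen_integral (Suc k) g (- a) z = (- z) * a * gegen_integral k (g + 1) (- (a + 1)) z"
    using gegen_integral_Suc[OF Suc.prems z, of k "- a"] by simp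
  also have "gegen_integral k (g + 1) (- (a + 1)) z = (- z) ^ k * pochhammer (a + 1) k / pochhammer (g + 1) k *
      euler_integral (g + of_nat (Suc k)) (g + of_nat (Suc k)) (- (a + of_nat (Suc k))) z"
    using Suc.IH[of "g + 1" "a + 1"] Suc.prems by (simp add: add_ac)
  finally show ?case
    using \<open>g \<noteq> 0\<close> nonzero_mult_div_cancel_left[of g "gegen_integral (Suc k) g (- a) z"]
    by (simp add: pochhammer_rec mult_ac)
qed

section \<open>The quadratic transformation\<close>

lemma summable_hypergeo_2F1:
  fixes a b c w :: complex
  assumes c: "Re c > 0" and w: "norm w < 1"
  shows "summable (\<lambda>n. pochhammer a n * pochhammer b n / pochhammer c n * (w ^ n / fact n))"
proof -
  define t where "t = (\<lambda>n. pochhammer a n * pochhammer b n / pochhammer c n * (w ^ n / fact n))"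
  define r where "r = (\<lambda>n. (a + of_nat n) * (b + of_nat n) / ((c + of_nat n) * (1 + of_nat n)) * w)"
  have t_Suc: "t (Suc n) = r n * t n" for n
    by (simp add: t_def r_def pochhammer_rec' mult_ac)
  have lim1: "(\<lambda>n. (x + of_nat n) / (y + of_nat n)) \<longlonglongrightarrow> 1" for x y :: complex
  proof -
    have "(\<lambda>n. (x / of_nat n + 1) / (y / of_nat n + 1)) \<longlonglongrightarrow> (0 + 1) / (0 + 1)"
      by (intro tendsto_intros lim_const_over_n) auto
    moreover have "\<forall>\<^sub>F n in sequentially. (x / of_nat n + 1) / (y / of_nat n + 1) = (x + of_nat n) / (y + of_nat n)"
      using eventually_gt_at_top[of 0]
    proof eventually_elim
      case (elim n)
      then have "x / of_nat n + 1 = (x + of_nat n) / of_nat n" "y / of_nat n + 1 = (y + of_nat n) / of_nat n"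
        by (simp_all add: field_simps)
      then show ?case using elim by simp
    qed
    ultimately show ?thesis by (auto dest: Lim_transform_eventually)
  qed
  have "(\<lambda>n. ((a + of_nat n) / (c + of_nat n)) * ((b + of_nat n) / (1 + of_nat n)) * w) \<longlonglongrightarrow> 1 * 1 * w"
    by (intro tendsto_intros lim1)
  then have "r \<longlonglongrightarrow> w" by (simp add: r_def)
  then have "(\<lambda>n. norm (r n)) \<longlonglongrightarrow> norm w" by (rule tendsto_norm)
  moreover have "norm w < (1 + norm w) / 2" using w by simp
  ultimately have "\<forall>\<^sub>F n in sequentially. norm (r n) < (1 + norm w) / 2"
    by (rule order_tendstoD)
  then obtain N where N: "\<And>n. n \<ge> N \<Longrightarrow> norm (r n) < (1 + norm w) / 2"
    by (auto simp: eventually_sequentially)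
  have "summable t"
  proof (rule summable_ratio_test)
    show "(1 + norm w) / 2 < 1" using w by simp
    show "norm (t (Suc n)) \<le> (1 + norm w) / 2 * norm (t n)" if "n \<ge> N" for n
      unfolding t_Suc norm_mult using N[OF that] by (intro mult_right_mono) auto
  qed
  then show ?thesis by (simp add: t_def)
qed

lemma hypergeo_series_2F1_holomorphic:
  assumes c: "Re c > 0"
  shows "hypergeo_series [a, b] [c] holomorphic_on ball 0 1"
proof (rule power_series_holomorphic)
  fix w :: complex assume "w \<in> ball 0 1"
  then have "summable (\<lambda>n. pochhammer a n * pochhammer b n / pochhammer c n * (w ^ n / fact n))"
    by (intro summable_hypergeo_2F1 c) auto
  from summable_sums[OF this]
  show "(\<lambda>n. (pochhammer a n * pochhammer b n / (pochhammer c n * fact n)) * (w - 0) ^ n) sums hypergeo_series [a, b] [c] w"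
    by (simp add: hypergeo_series_def mult_ac)
qed

text \<open>The map \<open>\<rho> \<mapsto> -4\<rho>/(1 - \<rho>)\<^sup>2\<close> is \<open>1 - w\<^sup>2\<close> with \<open>w = (1 + \<rho>)/(1 - \<rho>)\<close> in the right half plane.\<close>

lemma koebe_in_cut_plane:
  assumes "norm \<rho> < 1"
  shows "- (4 * \<rho> / (1 - \<rho>) ^ 2) \<in> cut_plane"
proof -
  define w where "w = (1 + \<rho>) / (1 - \<rho>)"
  have nz: "1 - \<rho> \<noteq> 0" using assms by auto
  have "- (4 * \<rho> / (1 - \<rho>) ^ 2) = 1 - w ^ 2"
  proof -
    have "1 - w ^ 2 = ((1 - \<rho>) ^ 2 - (1 + \<rho>) ^ 2) / (1 - \<rho>) ^ 2"
      using nz by (simp add: w_def power_divide diff_divide_distrib)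
    also have "(1 - \<rho>) ^ 2 - (1 + \<rho>) ^ 2 = - (4 * \<rho>)"
      by (simp add: power2_eq_square algebra_simps)
    finally show ?thesis by simp
  qed
  moreover have Re_w: "Re w > 0"
  proof -
    have "w = (1 + \<rho>) * cnj (1 - \<rho>) / of_real ((norm (1 - \<rho>))\<^sup>2)"
      unfolding w_def complex_norm_square using nz by (simp del: complex_cnj_diff)
    then have "Re w = Re ((1 + \<rho>) * cnj (1 - \<rho>)) / (norm (1 - \<rho>))\<^sup>2"
      by (simp only: Re_divide_of_real)
    also have "Re ((1 + \<rho>) * cnj (1 - \<rho>)) = 1 - (norm \<rho>)\<^sup>2"
      unfolding cmod_power2 by (simp add: algebra_simps power2_eq_square)
    finally show ?thesis
      using assms nz by (simp add: power_less_one_iff abs_square_less_1)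
  qed
  have "\<not> Re w * Re w \<le> 0"
    using mult_pos_pos[OF Re_w Re_w] by linarith
  ultimately show ?thesis
    using Re_w by (auto simp: cut_plane_altdef power2_eq_square)
qed

text \<open>The coefficient of r^(2n) in the double series below. With i = n - l and (2i)! = 4^i
  (1/2)_i i!, the factors (1/2)_i and 4^i cancel, leaving 2F1(-n, a + n; b + 1/2; 1).\<close>

lemma quadratic_transformation_coeff:
  fixes a b :: complex
  assumes b: "Re b > 0"
  shows "(\<Sum>l\<le>n. pochhammer a (2 * n - l) / (fact (2 * n - 2 * l) * fact l) * 2 ^ (2 * n - 2 * l) * (- 1) ^ l
            * (pochhammer (1 / 2) (n - l) / pochhammer (b + 1 / 2) (n - l))) =
         pochhammer a n * pochhammer (a - b + 1 / 2) n / (pochhammer (b + 1 / 2) n * fact n)"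
proof -
  have b': "Re (b + 1 / 2) > 0" using b by simp
  have "(\<Sum>l\<le>n. pochhammer a (2 * n - l) / (fact (2 * n - 2 * l) * fact l) * 2 ^ (2 * n - 2 * l) * (- 1) ^ l
            * (pochhammer (1 / 2) (n - l) / pochhammer (b + 1 / 2) (n - l))) =
        (\<Sum>i\<le>n. pochhammer a (n + i) / (fact (2 * i) * fact (n - i)) * 2 ^ (2 * i) * (- 1) ^ (n - i)
            * (pochhammer (1 / 2) i / pochhammer (b + 1 / 2) i))"
  proof (rule sum.reindex_bij_witness[of _ "\<lambda>i. n - i" "\<lambda>l. n - l"])
    fix l assume "l \<in> {..n}"
    then have "n + (n - l) = 2 * n - l" "2 * (n - l) = 2 * n - 2 * l" "n - (n - l) = l" by auto
    then show "pochhammer a (n + (n - l)) / (fact (2 * (n - l)) * fact (n - (n - l))) * 2 ^ (2 * (n - l)) * (- 1) ^ (n - (n - l))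
            * (pochhammer (1 / 2) (n - l) / pochhammer (b + 1 / 2) (n - l)) =
       pochhammer a (2 * n - l) / (fact (2 * n - 2 * l) * fact l) * 2 ^ (2 * n - 2 * l) * (- 1) ^ l
            * (pochhammer (1 / 2) (n - l) / pochhammer (b + 1 / 2) (n - l))"
      by (simp only:)
  qed auto
  also have "\<dots> = (\<Sum>i\<le>n. pochhammer a n * (- 1) ^ n / fact n * (pochhammer (- of_nat n) i *
      pochhammer (a + of_nat n) i / (pochhammer (b + 1 / 2) i * fact i)))"
  proof (intro sum.cong refl)
    fix i assume "i \<in> {..n}"
    then have i: "i \<le> n" by simp
    have f2: "fact (2 * i) = 2 ^ (2 * i) * pochhammer (1 / 2) i * (fact i :: complex)"
      using pochhammer_double[of "1 / 2 :: complex" i] by (simp add: pochhammer_fact)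
    have half: "pochhammer (1 / 2 :: complex) i \<noteq> 0" by (rule pochhammer_Re_pos_nonzero) simp
    have "(- 1 :: complex) ^ (n - i) = (- 1) ^ n * (- 1) ^ i"
      using i by (metis (no_types, lifting) add_diff_inverse_nat left_minus_one_mult_self linorder_not_le power_add mult.commute)
    then have sg: "(- 1) ^ (n - i) / fact (n - i) = (- 1) ^ n * (pochhammer (- of_nat n) i / fact n :: complex)"
      by (simp add: pochhammer_neg_of_nat_div_fact[OF i])
    have "pochhammer a (n + i) / (fact (2 * i) * fact (n - i)) * 2 ^ (2 * i) * (- 1) ^ (n - i)
            * (pochhammer (1 / 2) i / pochhammer (b + 1 / 2) i) =
          pochhammer a n * pochhammer (a + of_nat n) i * ((- 1) ^ (n - i) / fact (n - i)) / (pochhammer (b + 1 / 2) i * fact i)"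
      unfolding f2 pochhammer_product' using half by (simp add: mult_ac)
    then show "pochhammer a (n + i) / (fact (2 * i) * fact (n - i)) * 2 ^ (2 * i) * (- 1) ^ (n - i)
            * (pochhammer (1 / 2) i / pochhammer (b + 1 / 2) i) =
         pochhammer a n * (- 1) ^ n / fact n * (pochhammer (- of_nat n) i *
      pochhammer (a + of_nat n) i / (pochhammer (b + 1 / 2) i * fact i))"
      unfolding sg by (simp add: mult_ac)
  qed
  also have "\<dots> = pochhammer a n * (- 1) ^ n / fact n * (pochhammer (b + 1 / 2 - (a + of_nat n)) n / pochhammer (b + 1 / 2) n)"
    unfolding sum_distrib_left[symmetric] hypergeo_2F1_at_1_terminating[OF b'] ..
  also have "b + 1 / 2 - (a + of_nat n) = - (a - b - 1 / 2 + of_nat n)" by simp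
  also have "pochhammer (- (a - b - 1 / 2 + of_nat n)) n = (- 1) ^ n * pochhammer (a - b + 1 / 2) n"
    by (subst pochhammer_minus) (simp add: algebra_simps)
  finally show ?thesis by (simp add: mult_ac)
qed

text \<open>For z = -4r/(1 - r)^2 one has (1 - r)^2 (1 - zt) = 1 - 2r(1 - 2t) + r^2, the base in the
  generating function of the Gegenbauer polynomials. For real r all bases are positive, so
  logarithms add without branch corrections.\<close>

lemma powr_koebe_real:
  fixes r t :: real and a :: complex
  assumes "0 \<le> r" "r < 1" "0 \<le> t" "t \<le> 1"
  shows "(1 - of_real r) powr (- 2 * a) * (1 - - (4 * of_real r / (1 - of_real r) ^ 2) * of_real t) powr (- a) =
         (1 - of_real (r * (2 * (1 - 2 * t) - r))) powr (- a)"
proof -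
  define X where "X = 1 + 4 * r / (1 - r)\<^sup>2 * t"
  have X: "X > 0" using assms by (simp add: X_def add_pos_nonneg)
  have r: "1 - r > 0" using assms by simp
  have eq: "(1 - r)\<^sup>2 * X = 1 - r * (2 * (1 - 2 * t) - r)"
    unfolding X_def using r by (simp add: distrib_left) (simp add: power2_eq_square algebra_simps)
  have ln: "ln (1 - r * (2 * (1 - 2 * t) - r)) = 2 * ln (1 - r) + ln X"
    unfolding eq[symmetric] using r X by (simp add: ln_mult ln_realpow)
  have pos: "1 - r * (2 * (1 - 2 * t) - r) > 0"
    unfolding eq[symmetric] using r X by simp
  have powr: "complex_of_real x powr e = exp (e * of_real (ln x))" if "x > 0" for x e
    using that by (simp add: powr_def Ln_of_real)
  have "(1 - of_real r) = complex_of_real (1 - r)"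
    "(1 - - (4 * of_real r / (1 - of_real r) ^ 2) * of_real t) = complex_of_real X"
    "(1 - of_real (r * (2 * (1 - 2 * t) - r))) = complex_of_real (1 - r * (2 * (1 - 2 * t) - r))"
    by (simp_all add: X_def)
  then show ?thesis
    by (simp only: powr[OF r] powr[OF X] powr[OF pos] ln exp_add[symmetric]) (simp add: algebra_simps)
qed

text \<open>
  For small real \<open>r\<close> the integrand expands in powers of \<open>r(2y - r)\<close> with \<open>y = 1 - 2\<sigma>\<close>. The resulting
  double series converges absolutely; collecting the total power of \<open>r\<close> leaves a terminating
  \<open>\<^sub>2F\<^sub>1\<close> at \<open>1\<close> in each even degree. The identity theorem then covers the unit disc.
\<close>

lemma euler_integral_koebe_real:
  fixes a b :: complex and r :: real
  assumes b: "Re b > 0" and r: "0 < r" "r < 1 / 4"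
  shows "(1 - of_real r) powr (- 2 * a) * euler_integral b b (- a) (- (4 * of_real r / (1 - of_real r) ^ 2)) =
         Beta b b * hypergeo_series [a, a - b + 1 / 2] [b + 1 / 2] (of_real r ^ 2)"
proof -
  define y where "y = (\<lambda>u. 1 - 2 * logistic u)"
  define c where "c = (\<lambda>m. pochhammer a m / fact m)"
  define L where "L = (1 - of_real r) powr (- 2 * a) * euler_integral b b (- a) (- (4 * of_real r / (1 - of_real r) ^ 2))"
  define f where "f = (\<lambda>m u. beta_kernel b b u * (c m * of_real (r * (2 * y u - r)) ^ m))"
  define K where "K = (\<integral>u. norm (beta_kernel b b u) \<partial>lborel)"
  \<comment> \<open>The integrated l-th binomial term of (r(2y - r))^m in the m-th term of the
    series; it has degree m + l in r.\<close>
  define T where "T = (\<lambda>(m, l). c m * of_nat (m choose l) * 2 ^ (m - l) * (- 1) ^ l * of_real r ^ (m + l) * symmetric_moment b (m - l))"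
  have y_le: "\<bar>y u\<bar> \<le> 1" for u
    using logistic_bounds[of u] unfolding y_def abs_le_iff by linarith
  have w_le: "\<bar>r * (2 * y u - r)\<bar> \<le> r * (2 + r)" for u
    using r y_le[of u] unfolding abs_mult by (intro mult_mono) (auto simp: abs_le_iff)
  \<comment> \<open>Taking absolute values in r(2y - r) gives r(2 + r). The restriction r < 1/4
    keeps this below 9/16, inside the disc of convergence even after the binomial expansion.\<close>
  have "r * (2 + r) < 1 / 4 * (2 + 1 / 4)"
    using r by (intro mult_strict_mono) auto
  then have q: "0 \<le> r * (2 + r)" "r * (2 + r) < 1" using r by auto
  have bk: "integrable lborel (beta_kernel b b)"
    using b by (intro integrable_beta_kernel)
  have mom: "integrable lborel (\<lambda>u. beta_kernel b b u * (1 - 2 * of_real (logistic u)) ^ n)" for n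
    by (intro integrable_beta_kernel_mult[where h = "\<lambda>t. (1 - 2 * of_real t) ^ n"] b continuous_intros)
  have mom_le: "norm (symmetric_moment b n) \<le> K" for n
  proof -
    have "norm (symmetric_moment b n) \<le> (\<integral>u. norm (beta_kernel b b u * (1 - 2 * of_real (logistic u)) ^ n) \<partial>lborel)"
      unfolding symmetric_moment_def by (rule integral_norm_bound)
    also have "\<dots> \<le> K"
      unfolding K_def
    proof (rule integral_mono[OF integrable_norm[OF mom] integrable_norm[OF bk]])
      fix u
      have "1 - 2 * complex_of_real (logistic u) = of_real (y u)"
        by (simp add: y_def)
      then have "norm (1 - 2 * complex_of_real (logistic u)) = \<bar>y u\<bar>"
        by (simp only: norm_of_real)
      then have "norm (1 - 2 * complex_of_real (logistic u)) ^ n \<le> 1"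
        using y_le[of u] by (simp add: power_le_one)
      then show "norm (beta_kernel b b u * (1 - 2 * of_real (logistic u)) ^ n) \<le> norm (beta_kernel b b u)"
        unfolding norm_mult norm_power by (intro mult_right_le_one_le) auto
    qed
    finally show ?thesis .
  qed
  have binom: "of_real (r * (2 * y u - r)) ^ m =
      (\<Sum>l\<le>m. of_nat (m choose l) * 2 ^ (m - l) * (- 1) ^ l * of_real r ^ (m + l) * (1 - 2 * complex_of_real (logistic u)) ^ (m - l))" for u m
  proof -
    have "of_real (r * (2 * y u - r)) ^ m = (- (of_real r ^ 2) + 2 * of_real r * (1 - 2 * complex_of_real (logistic u))) ^ m"
      by (simp add: y_def power2_eq_square algebra_simps)
    also have "\<dots> = (\<Sum>l\<le>m. of_nat (m choose l) * (- (of_real r ^ 2)) ^ l * (2 * of_real r * (1 - 2 * complex_of_real (logistic u))) ^ (m - l))"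
      by (rule binomial_ring)
    also have "\<dots> = (\<Sum>l\<le>m. of_nat (m choose l) * 2 ^ (m - l) * (- 1) ^ l * of_real r ^ (m + l) * (1 - 2 * complex_of_real (logistic u)) ^ (m - l))"
    proof (intro sum.cong refl)
      fix l assume l: "l \<in> {..m}"
      then have "m + l = 2 * l + (m - l)" by simp
      then have "complex_of_real r ^ (m + l) = (of_real r ^ 2) ^ l * of_real r ^ (m - l)"
        by (simp only: power_add power_mult)
      then show "of_nat (m choose l) * (- (of_real r ^ 2)) ^ l * (2 * of_real r * (1 - 2 * complex_of_real (logistic u))) ^ (m - l)
         = of_nat (m choose l) * 2 ^ (m - l) * (- 1) ^ l * of_real r ^ (m + l) * (1 - 2 * complex_of_real (logistic u)) ^ (m - l)"
        by (simp add: power_mult_distrib power_minus[of "of_real r ^ 2"])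
    qed
    finally show ?thesis .
  qed
  have int_f: "(\<integral>u. f m u \<partial>lborel) = (\<Sum>l\<le>m. T (m, l))" for m
  proof -
    have "(\<integral>u. f m u \<partial>lborel) = (\<integral>u. (\<Sum>l\<le>m. (c m * of_nat (m choose l) * 2 ^ (m - l) * (- 1) ^ l * of_real r ^ (m + l)) *
        (beta_kernel b b u * (1 - 2 * of_real (logistic u)) ^ (m - l))) \<partial>lborel)"
      unfolding f_def binom sum_distrib_left by (simp add: mult_ac)
    also have "\<dots> = (\<Sum>l\<le>m. T (m, l))"
      by (subst Bochner_Integration.integral_sum)
         (intro integrable_mult_right mom | simp add: T_def symmetric_moment_def)+
    finally show ?thesis .
  qed
  have f: "integrable lborel (f m)" for m
    unfolding f_def y_def
    by (intro integrable_beta_kernel_mult[where h = "\<lambda>t. c m * of_real (r * (2 * (1 - 2 * t) - r)) ^ m"] b continuous_intros)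
  have f_le: "norm (f m u) \<le> norm (c m) * (r * (2 + r)) ^ m * norm (beta_kernel b b u)" for m u
  proof -
    have "norm (complex_of_real (r * (2 * y u - r))) ^ m \<le> (r * (2 + r)) ^ m"
      unfolding norm_of_real by (intro power_mono w_le) auto
    then have "norm (c m) * norm (beta_kernel b b u) * norm (complex_of_real (r * (2 * y u - r))) ^ m \<le> norm (c m) * norm (beta_kernel b b u) * (r * (2 + r)) ^ m"
      by (intro mult_left_mono) auto
    then show ?thesis by (simp only: f_def norm_mult norm_power mult_ac)
  qed
  have sm: "summable (\<lambda>m. norm (c m) * (r * (2 + r)) ^ m * C)" for C
    unfolding c_def using q by (intro summable_mult2 summable_norm_binomial_series)
  have "(\<lambda>m. \<integral>u. f m u \<partial>lborel) sums (\<integral>u. (\<Sum>m. f m u) \<partial>lborel)"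
  proof (rule sums_integral[OF f])
    show "AE u in lborel. summable (\<lambda>m. norm (f m u))"
      by (intro AE_I2 summable_comparison_test'[OF sm]) (use f_le in auto)
    show "summable (\<lambda>m. \<integral>u. norm (f m u) \<partial>lborel)"
    proof (rule summable_comparison_test'[OF sm])
      fix m
      have "(\<integral>u. norm (f m u) \<partial>lborel) \<le> (\<integral>u. norm (c m) * (r * (2 + r)) ^ m * norm (beta_kernel b b u) \<partial>lborel)"
        by (intro integral_mono f_le integrable_norm f integrable_mult_right bk)
      then show "norm (\<integral>u. norm (f m u) \<partial>lborel) \<le> norm (c m) * (r * (2 + r)) ^ m * K"
        by (simp add: K_def)
    qed
  qed
  moreover have "(\<integral>u. (\<Sum>m. f m u) \<partial>lborel) = L"
  proof -
    have "(\<Sum>m. f m u) = (1 - of_real r) powr (- 2 * a) *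
       (beta_kernel b b u * (1 - - (4 * of_real r / (1 - of_real r) ^ 2) * of_real (logistic u)) powr (- a))" for u
    proof -
      have "norm (complex_of_real (r * (2 * y u - r))) < 1"
        unfolding norm_of_real using w_le[of u] q by linarith
      from sums_mult[OF binomial_series_pochhammer[OF this, of a], of "beta_kernel b b u"]
      have "(\<Sum>m. f m u) = beta_kernel b b u * (1 - of_real (r * (2 * (1 - 2 * logistic u) - r))) powr (- a)"
        unfolding f_def c_def y_def by (simp only: sums_iff)
      also have "(1 - of_real (r * (2 * (1 - 2 * logistic u) - r))) powr (- a) = (1 - of_real r) powr (- 2 * a) *
         (1 - - (4 * of_real r / (1 - of_real r) ^ 2) * of_real (logistic u)) powr (- a)"
        using r by (intro powr_koebe_real[symmetric]) auto
      finally show ?thesis by (simp only: mult_ac)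
    qed
    then show ?thesis
      by (simp only: L_def euler_integral_def integral_mult_right_zero)
  qed
  ultimately have sums_L: "(\<lambda>m. \<Sum>l\<le>m. T (m, l)) sums L"
    by (simp only: int_f)

  \<comment> \<open>By the binomial theorem the norms in row m add up to at most |c m| (r(2 + r))^m
    K. This absolute convergence justifies the regrouping by degree.\<close>
  have "(\<lambda>x. norm (T x)) summable_on Sigma UNIV (\<lambda>m. {..m})"
    unfolding Infinite_Sum.abs_summable_on_Sigma_iff
  proof (intro conjI ballI)
    have le: "(\<Sum>l\<le>m. norm (T (m, l))) \<le> norm (c m) * (r * (2 + r)) ^ m * K" for m
    proof -
      have "(\<Sum>l\<le>m. norm (T (m, l))) \<le> (\<Sum>l\<le>m. norm (c m) * r ^ m * K * (of_nat (m choose l) * r ^ l * 2 ^ (m - l)))"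
      proof (intro sum_mono)
        fix l
        have "norm (T (m, l)) = norm (c m) * r ^ m * (of_nat (m choose l) * r ^ l * 2 ^ (m - l)) * norm (symmetric_moment b (m - l))"
          using r by (simp add: T_def norm_mult norm_power power_add)
        also have "\<dots> \<le> norm (c m) * r ^ m * (of_nat (m choose l) * r ^ l * 2 ^ (m - l)) * K"
          using r by (intro mult_left_mono mom_le) auto
        finally show "norm (T (m, l)) \<le> norm (c m) * r ^ m * K * (of_nat (m choose l) * r ^ l * 2 ^ (m - l))"
          by (simp only: mult_ac)
      qed
      also have "\<dots> = norm (c m) * r ^ m * K * (r + 2) ^ m"
        unfolding sum_distrib_left[symmetric] binomial_ring ..
      finally show ?thesis by (simp add: power_mult_distrib add.commute mult_ac)
    qed
    show "(\<lambda>m. norm (infsum (\<lambda>l. norm (T (m, l))) {..m})) summable_on UNIV"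
      using le by (intro norm_summable_imp_summable_on summable_comparison_test'[OF sm]) (auto simp: sum_nonneg)
  qed auto
  then have "T summable_on Sigma UNIV (\<lambda>m. {..m})"
    by (rule Infinite_Sum.abs_summable_summable)
  then obtain S where S: "(T has_sum S) (Sigma UNIV (\<lambda>m. {..m}))"
    by (auto simp: summable_on_def)
  have "((\<lambda>m. \<Sum>l\<le>m. T (m, l)) has_sum S) UNIV"
    by (rule has_sum_SigmaD[OF S]) (auto intro: has_sum_finite)
  then have "(\<lambda>m. \<Sum>l\<le>m. T (m, l)) sums S" by (rule has_sum_imp_sums)
  with sums_L have "S = L" by (rule sums_unique2[symmetric])

  \<comment> \<open>Enumerates the pairs (m, l) of even degree m + l = 2n; the constraint l \<le> m
    becomes l \<le> n. The pairs that are missed have odd m - l, and their moments vanish.\<close>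
  define h where "h = (\<lambda>(n::nat, l::nat). (2 * n - l, l))"
  have inj: "inj_on h (Sigma UNIV (\<lambda>n. {..n}))"
    by (auto simp: h_def inj_on_def)
  have "(T has_sum L) (h ` Sigma UNIV (\<lambda>n. {..n}))"
  proof (rule iffD2[OF has_sum_cong_neutral S[unfolded \<open>S = L\<close>]])
    fix x assume x: "x \<in> Sigma UNIV (\<lambda>m. {..m}) - h ` Sigma UNIV (\<lambda>n. {..n})"
    obtain m l where ml: "x = (m, l)" "l \<le> m" using x by auto
    have "odd (m - l)"
    proof
      assume "even (m - l)"
      then have "x = h ((m + l) div 2, l)" "l \<le> (m + l) div 2"
        using ml by (auto simp: h_def)
      then show False using x by blast
    qed
    then show "T x = 0" using ml b by (simp add: T_def symmetric_moment_odd)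
  qed (auto simp: h_def)
  then have "((T \<circ> h) has_sum L) (Sigma UNIV (\<lambda>n. {..n}))"
    by (simp only: has_sum_reindex[OF inj])
  then have "((\<lambda>n. \<Sum>l\<le>n. (T \<circ> h) (n, l)) has_sum L) UNIV"
    by (rule has_sum_SigmaD) (auto intro: has_sum_finite)
  then have "(\<lambda>n. \<Sum>l\<le>n. (T \<circ> h) (n, l)) sums L" by (rule has_sum_imp_sums)
  moreover have "(\<Sum>l\<le>n. (T \<circ> h) (n, l)) = Beta b b * (pochhammer a n * pochhammer (a - b + 1 / 2) n /
      (pochhammer (b + 1 / 2) n * fact n)) * (of_real r ^ 2) ^ n" for n
  proof -
    have "(\<Sum>l\<le>n. (T \<circ> h) (n, l)) = (\<Sum>l\<le>n. (Beta b b * of_real r ^ (2 * n)) * (pochhammer a (2 * n - l) / (fact (2 * n - 2 * l) * fact l) * 2 ^ (2 * n - 2 * l) * (- 1) ^ l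
            * (pochhammer (1 / 2) (n - l) / pochhammer (b + 1 / 2) (n - l))))"
    proof (intro sum.cong refl)
      fix l assume l: "l \<in> {..n}"
      have "c (2 * n - l) * of_nat (2 * n - l choose l) = pochhammer a (2 * n - l) / (fact (2 * n - 2 * l) * fact l)"
        using l by (simp add: c_def binomial_fact mult_2[of l])
      moreover have "symmetric_moment b (2 * n - l - l) = Beta b b * pochhammer (1 / 2) (n - l) / pochhammer (b + 1 / 2) (n - l)"
        using symmetric_moment_even[OF b, of "n - l"] by (simp add: diff_mult_distrib2 mult_2[of l])
      moreover have "2 * n - l + l = 2 * n" "2 * n - l - l = 2 * n - 2 * l" using l by auto
      ultimately show "(T \<circ> h) (n, l) = (Beta b b * of_real r ^ (2 * n)) * (pochhammer a (2 * n - l) / (fact (2 * n - 2 * l) * fact l) * 2 ^ (2 * n - 2 * l) * (- 1) ^ l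
            * (pochhammer (1 / 2) (n - l) / pochhammer (b + 1 / 2) (n - l)))"
        by (simp add: T_def h_def)
    qed
    then show ?thesis
      unfolding sum_distrib_left[symmetric] quadratic_transformation_coeff[OF b] power_mult by (simp add: mult_ac)
  qed
  ultimately have sums_L': "(\<lambda>n. Beta b b * (pochhammer a n * pochhammer (a - b + 1 / 2) n /
      (pochhammer (b + 1 / 2) n) * ((of_real r ^ 2) ^ n / fact n))) sums L"
    by (simp add: mult_ac)
  have "summable (\<lambda>n. pochhammer a n * pochhammer (a - b + 1 / 2) n /
      (pochhammer (b + 1 / 2) n) * ((complex_of_real r ^ 2) ^ n / fact n))"
    using b r by (intro summable_hypergeo_2F1) (auto simp: norm_power power_less_one_iff abs_square_less_1)
  from sums_unique2[OF sums_L' sums_mult[OF summable_sums[OF this]]]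
  have "L = Beta b b * hypergeo_series [a, a - b + 1 / 2] [b + 1 / 2] (of_real r ^ 2)"
    by (simp only: hypergeo_series_def list.map prod_list.Cons prod_list.Nil mult_1_right)
  then show ?thesis
    by (simp only: L_def)
qed

text \<open>Gauss's quadratic transformation for 2F1(a, b; 2b; .), multiplied by Beta(b, b).
  Continuation in \<rho> is possible because z stays in the cut plane and 1 - \<rho> in the right
  half plane.\<close>

lemma euler_integral_koebe:
  fixes a b \<rho> :: complex
  assumes b: "Re b > 0" and \<rho>: "norm \<rho> < 1"
  shows "(1 - \<rho>) powr (- 2 * a) * euler_integral b b (- a) (- (4 * \<rho> / (1 - \<rho>) ^ 2)) =
         Beta b b * hypergeo_series [a, a - b + 1 / 2] [b + 1 / 2] (\<rho> ^ 2)"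
proof (rule holomorphic_eq_from_real_interval
    [where S = "ball 0 1" and x = 0 and y = "1 / 4" and z = \<rho>
       and f = "\<lambda>\<rho>. (1 - \<rho>) powr (- 2 * a) * euler_integral b b (- a) (- (4 * \<rho> / (1 - \<rho>) ^ 2))"
       and g = "\<lambda>\<rho>. Beta b b * hypergeo_series [a, a - b + 1 / 2] [b + 1 / 2] (\<rho> ^ 2)"])
  have "1 - \<rho> \<notin> \<real>\<^sub>\<le>\<^sub>0" if "\<rho> \<in> ball 0 1" for \<rho> :: complex
    using that abs_Re_le_cmod[of \<rho>] by (auto simp: complex_nonpos_Reals_iff)
  moreover have "(\<lambda>\<rho>. euler_integral b b (- a) (- (4 * \<rho> / (1 - \<rho>) ^ 2))) holomorphic_on ball 0 1"
  proof (rule holomorphic_on_compose_gen[unfolded o_def, OF _ euler_integral_holomorphic[OF b b]])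
    show "(\<lambda>\<rho>. - (4 * \<rho> / (1 - \<rho>) ^ 2)) holomorphic_on ball 0 1"
      by (intro holomorphic_intros) auto
  qed (auto intro: koebe_in_cut_plane)
  ultimately show "(\<lambda>\<rho>. (1 - \<rho>) powr (- 2 * a) * euler_integral b b (- a) (- (4 * \<rho> / (1 - \<rho>) ^ 2))) holomorphic_on ball 0 1"
    by (intro holomorphic_on_mult holomorphic_on_powr holomorphic_intros) auto
  have "(\<lambda>\<rho>. hypergeo_series [a, a - b + 1 / 2] [b + 1 / 2] (\<rho> ^ 2)) holomorphic_on ball 0 1"
    by (rule holomorphic_on_compose_gen[unfolded o_def, OF _ hypergeo_series_2F1_holomorphic])
       (use b in \<open>auto intro!: holomorphic_intros simp: norm_power power_less_one_iff abs_square_less_1\<close>)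
  then show "(\<lambda>\<rho>. Beta b b * hypergeo_series [a, a - b + 1 / 2] [b + 1 / 2] (\<rho> ^ 2)) holomorphic_on ball 0 1"
    by (intro holomorphic_intros)
  show "(1 - of_real t) powr (- 2 * a) * euler_integral b b (- a) (- (4 * of_real t / (1 - of_real t) ^ 2)) =
         Beta b b * hypergeo_series [a, a - b + 1 / 2] [b + 1 / 2] (of_real t ^ 2)" if "0 < t" "t < 1 / 4" for t
    using b that by (rule euler_integral_koebe_real)
qed (use \<rho> in auto)

section \<open>The integral\<close>

text \<open>The logarithms of \<open>logistic u\<close> and \<open>1 - logistic u\<close> differ by
  u, so opposite imaginary shifts of the exponents combine to a character.\<close>

lemma beta_kernel_iexp:
  "beta_kernel (p + \<i> * of_real x) (q - \<i> * of_real x) u = beta_kernel p q u * iexp (x * u)"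
proof -
  have ln: "ln (1 - logistic u) = ln (logistic u) - u"
    unfolding one_minus_logistic by (simp add: ln_mult)
  have powr: "complex_of_real t powr e = exp (e * of_real (ln t))" if "t > 0" for t e
    using that by (simp add: powr_def Ln_of_real)
  have pos: "logistic u > 0" "1 - logistic u > 0" by simp_all
  show ?thesis
    unfolding beta_kernel_def powr[OF pos(1)] powr[OF pos(2)] ln
    by (simp add: exp_add[symmetric] algebra_simps)
qed

lemma norm_beta_kernel_le_1:
  assumes "Re p > 0" "Re q > 0"
  shows "norm (beta_kernel p q u) \<le> 1"
  unfolding norm_beta_kernel using assms by (intro mult_le_one powr_le1) auto

lemma beta_kernel_mult:
  "beta_kernel p q u * beta_kernel p' q' u = beta_kernel (p + p') (q + q') u"
  by (simp add: beta_kernel_def powr_add mult_ac)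

text \<open>Parseval's identity takes its second transform at -x; hence the signs of ix are
  interchanged in the second kernel.\<close>

lemma has_bochner_integral_beta_kernel_fourier:
  fixes h h' :: "real \<Rightarrow> complex"
  assumes pos: "A > 0" "C > 0"
    and h: "continuous_on {0..1} h" and h': "continuous_on {0..1} h'"
  shows "has_bochner_integral lborel
    (\<lambda>x. (\<integral>u. beta_kernel (of_real A + \<i> * of_real x) (of_real A - \<i> * of_real x) u * h (logistic u) \<partial>lborel) *
         (\<integral>u. beta_kernel (of_real C - \<i> * of_real x) (of_real C + \<i> * of_real x) u * h' (logistic u) \<partial>lborel))
    (2 * pi * (\<integral>u. beta_kernel (of_real (A + C)) (of_real (A + C)) u * (h' (logistic u) * h (logistic u)) \<partial>lborel))"
proof -
  have bdd: "\<exists>M. \<forall>u. norm (beta_kernel (of_real A) (of_real A) u * h (logistic u)) \<le> M"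
    if "A > 0" and h: "continuous_on {0..1} h" for A h
  proof -
    obtain M where M: "\<And>t. t \<in> {0..1} \<Longrightarrow> norm (h t) \<le> M"
      using bounded_on_unit_interval[OF h] by blast
    have "norm (beta_kernel (of_real A) (of_real A) u * h (logistic u)) \<le> 1 * M" for u
      unfolding norm_mult by (intro mult_mono norm_beta_kernel_le_1 M) (use \<open>A > 0\<close> in auto)
    then show ?thesis by blast
  qed
  obtain M M' where "\<And>u. norm (beta_kernel (of_real A) (of_real A) u * h (logistic u)) \<le> M"
    "\<And>u. norm (beta_kernel (of_real C) (of_real C) u * h' (logistic u)) \<le> M'"
    using bdd[OF pos(1) h] bdd[OF pos(2) h'] by blast
  then have "has_bochner_integral lborel
    (\<lambda>x. (\<integral>u. beta_kernel (of_real A) (of_real A) u * h (logistic u) * iexp (x * u) \<partial>lborel) *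
         (\<integral>v. beta_kernel (of_real C) (of_real C) v * h' (logistic v) * iexp (- x * v) \<partial>lborel))
    (2 * pi * (\<integral>v. beta_kernel (of_real A) (of_real A) v * h (logistic v) *
        (beta_kernel (of_real C) (of_real C) v * h' (logistic v)) \<partial>lborel))"
    using pos by (intro parseval integrable_beta_kernel_mult h h' continuous_on_mult
        continuous_on_beta_kernel continuous_on_logistic_compose) auto
  moreover have "beta_kernel (of_real A) (of_real A) v * h (logistic v) *
        (beta_kernel (of_real C) (of_real C) v * h' (logistic v)) =
      beta_kernel (of_real (A + C)) (of_real (A + C)) v * (h' (logistic v) * h (logistic v))" for v
    unfolding of_real_add beta_kernel_mult[symmetric] by (simp only: mult_ac)
  moreover have "beta_kernel (of_real A) (of_real A) u * h (logistic u) * iexp (x * u) =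
      beta_kernel (of_real A + \<i> * of_real x) (of_real A - \<i> * of_real x) u * h (logistic u)" for u x
    unfolding beta_kernel_iexp by (simp only: mult_ac)
  moreover have "beta_kernel (of_real C) (of_real C) u * h' (logistic u) * iexp (- x * u) =
      beta_kernel (of_real C - \<i> * of_real x) (of_real C + \<i> * of_real x) u * h' (logistic u)" for u x
    using beta_kernel_iexp[of "of_real C" "- x" "of_real C" u] by simp
  ultimately show ?thesis by (simp only:)
qed

lemma integral_beta_kernel_gegen_poly:
  assumes pq: "Re p > 0" "Re q > 0"
  shows "(\<integral>u. beta_kernel p q u * poly (gegen_poly k g) (of_real (logistic u)) \<partial>lborel) =
    Beta p q * (\<Sum>j\<le>k. gegen_coeff k g j * pochhammer p j / pochhammer (p + q) j)"
proof -
  have "(\<integral>u. beta_kernel p q u * poly (gegen_poly k g) (of_real (logistic u)) \<partial>lborel) =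
      (\<integral>u. (\<Sum>j\<le>k. gegen_coeff k g j * beta_kernel (p + of_nat j) q u) \<partial>lborel)"
    unfolding poly_gegen_poly beta_kernel_mult_power[symmetric] sum_distrib_left
    by (simp only: mult_ac)
  also have "\<dots> = (\<Sum>j\<le>k. gegen_coeff k g j * Beta (p + of_nat j) q)"
    using pq by (subst Bochner_Integration.integral_sum)
      (auto intro!: integrable_beta_kernel simp: integral_beta_kernel)
  finally show ?thesis
    using pq by (simp add: Beta_plus_of_nat sum_distrib_left mult_ac)
qed

text \<open>Trades the Gamma weights for the Beta factors that the Fourier transforms carry.\<close>

lemma Beta_conjugate:
  "Beta (of_real A + \<i> * of_real x) (of_real A - \<i> * of_real x) * Gamma (of_real (2 * A)) =
     of_real ((norm (Gamma (of_real A + \<i> * of_real x)))\<^sup>2)" if "A > 0"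
proof -
  have "Gamma (of_real (2 * A) :: complex) \<noteq> 0"
    using that Re_pos_not_nonpos_Int[of "of_real (2 * A)"] by (simp add: Gamma_eq_zero_iff)
  moreover have "of_real A - \<i> * of_real x = cnj (of_real A + \<i> * of_real x)" by simp
  ultimately show ?thesis
    unfolding complex_norm_square cnj_Gamma by (simp add: Beta_def)
qed

text \<open>The 3F2 transformation replaces a + ix by (A + C) - (a + ix) = C - i(x + Im a) and 2A by
  2C, which matches the Fourier transform of the C-kernel times a Gegenbauer polynomial. Its sign
  turns i^k into (-i)^k.\<close>

lemma continuous_Hahn_swap:
  fixes a c :: complex and x :: real
  assumes pos: "Re a > 0" "Re c > 0" and Im: "Im a = Im c"
  shows "continuous_Hahn k a c (of_real x) =
    (- \<i>) ^ k * pochhammer (of_real (2 * Re c)) k * pochhammer (of_real (Re a + Re c)) k / fact k *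
    (\<Sum>j\<le>k. gegen_coeff k (of_real (Re a + Re c)) j * pochhammer (of_real (Re c) - \<i> * of_real (x + Im a)) j /
        pochhammer (of_real (2 * Re c)) j)"
proof -
  define g where "g = complex_of_real (Re a + Re c)"
  define d where "d = complex_of_real (2 * Re a)"
  define D where "D = complex_of_real (2 * Re c)"
  define e where "e = of_nat k + complex_of_real (2 * Re a + 2 * Re c - 1)"
  have ac: "a + cnj c = g" using Im by (simp add: g_def complex_eq_iff)
  have e: "e = d + D + of_nat k - 1" "e = of_nat k + 2 * g - 1"
    by (simp_all add: e_def d_def D_def g_def)
  have gb: "g - (a + \<i> * of_real x) = of_real (Re c) - \<i> * of_real (x + Im a)"
    by (simp add: g_def complex_eq_iff)
  have "hypergeo_series [- of_nat k, e, a + \<i> * of_real x] [d, g] 1 =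
      (\<Sum>j\<le>k. pochhammer (- of_nat k) j * pochhammer e j * pochhammer (a + \<i> * of_real x) j /
            (pochhammer d j * pochhammer g j * fact j))"
    unfolding hypergeo_series_def
    by (subst suminf_finite[of "{..k}"]) (auto simp: pochhammer_of_nat_eq_0_lemma mult_ac)
  moreover have reversal: "pochhammer d k * (\<Sum>j\<le>k. pochhammer (- of_nat k) j * pochhammer e j * pochhammer (a + \<i> * of_real x) j /
            (pochhammer d j * pochhammer g j * fact j)) =
      (- 1) ^ k * pochhammer D k * (\<Sum>j\<le>k. pochhammer (- of_nat k) j * pochhammer e j * pochhammer (g - (a + \<i> * of_real x)) j /
            (pochhammer D j * pochhammer g j * fact j))"
    by (rule hypergeo_3F2_at_1_terminating_reversal[OF e(1)]) (use pos in \<open>auto simp: d_def D_def g_def\<close>)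
  ultimately have "continuous_Hahn k a c (of_real x) = \<i> ^ k * pochhammer g k / fact k *
    (pochhammer d k * (\<Sum>j\<le>k. pochhammer (- of_nat k) j * pochhammer e j * pochhammer (a + \<i> * of_real x) j /
            (pochhammer d j * pochhammer g j * fact j)))"
    by (simp add: continuous_Hahn_def ac d_def[symmetric] e_def[symmetric] del: of_real_mult of_real_add of_real_diff)
  also have "\<dots> = \<i> ^ k * pochhammer g k / fact k * ((-1) ^ k * pochhammer D k *
     (\<Sum>j\<le>k. pochhammer (- of_nat k) j * pochhammer e j * pochhammer (of_real (Re c) - \<i> * of_real (x + Im a)) j /
            (pochhammer D j * pochhammer g j * fact j)))"
    unfolding gb[symmetric] reversal ..
  also have "(\<Sum>j\<le>k. pochhammer (- of_nat k) j * pochhammer e j * pochhammer (of_real (Re c) - \<i> * of_real (x + Im a)) j /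
            (pochhammer D j * pochhammer g j * fact j)) =
     (\<Sum>j\<le>k. gegen_coeff k g j * pochhammer (of_real (Re c) - \<i> * of_real (x + Im a)) j / pochhammer D j)"
    by (simp add: gegen_coeff_def e(2) mult_ac)
  also have "\<i> ^ k * pochhammer g k / fact k * ((-1) ^ k * pochhammer D k * S) =
    (- \<i>) ^ k * pochhammer D k * pochhammer g k / fact k * S" for S
    by (simp add: power_minus[of \<i>])
  finally show ?thesis by (simp only: g_def D_def)
qed

text \<open>Both T Gamma(T) = Gamma(T + 1) and (2k + T)(T/2)_k = T (T/2 + 1)_k hold away from T = 0.
  The resulting expression is continuous at 0, so it also gives the limit and the degenerate case
  needs no further treatment.\<close>

lemma Hahn_denom_eq:
  assumes "T > - 1"
  shows "Hahn_denom k T = Gamma (T + 1) * pochhammer (T / 2 + 1) k"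
proof -
  define D where "D = (\<lambda>t. (2 * real k + t) * Gamma t * pochhammer (t / 2) k)"
  have D: "D t = Gamma (t + 1) * pochhammer (t / 2 + 1) k" if "t > - 1" "t \<noteq> 0" for t
  proof -
    have "t \<notin> \<int>\<^sub>\<le>\<^sub>0" using that by (auto elim!: nonpos_Ints_cases)
    then have "Gamma (t + 1) = t * Gamma t" by (rule Gamma_plus1)
    moreover have "t * pochhammer (t / 2 + 1) k = (2 * real k + t) * pochhammer (t / 2) k"
      using pochhammer_rec[of "t / 2" k] pochhammer_rec'[of "t / 2" k] by (simp add: field_simps)
    ultimately show ?thesis by (simp add: D_def mult_ac)
  qed
  show ?thesis
  proof (cases "T = 0")
    case True
    have "((\<lambda>t. Gamma (t + 1) * pochhammer (t / 2 + 1) k) \<longlongrightarrow> Gamma (0 + 1) * pochhammer (0 / 2 + 1 :: real) k) (at 0)"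
      unfolding pochhammer_prod by (intro tendsto_intros) auto
    moreover have "\<forall>\<^sub>F t in at 0. Gamma (t + 1) * pochhammer (t / 2 + 1) k = D t"
      unfolding eventually_at by (rule exI[of _ 1]) (auto simp: dist_real_def D)
    ultimately have "(D \<longlongrightarrow> Gamma (0 + 1) * pochhammer (0 / 2 + 1) k) (at 0)"
      by (rule Lim_transform_eventually)
    then have "Lim (at 0) D = Gamma (0 + 1) * pochhammer (0 / 2 + 1) k"
      by (intro tendsto_Lim) auto
    then show ?thesis
      using True by (simp add: Hahn_denom_def D_def Let_def)
  next
    case False
    then show ?thesis
      using D[OF assms] by (simp add: Hahn_denom_def D_def Let_def)
  qed
qed

text \<open>The denominators of z^k are integer powers of 1 - \<rho>, so they merge with the
  principal power into exactly the exponent that \<open>euler_integral_koebe\<close> expects for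
  \<alpha> + k.\<close>

lemma koebe_power_mult_powr:
  fixes \<rho> \<alpha> :: complex
  assumes "norm \<rho> < 1"
  shows "(1 - \<rho>) powr (- 2 * \<alpha>) * (4 * \<rho> / (1 - \<rho>) ^ 2) ^ k = (4 * \<rho>) ^ k * (1 - \<rho>) powr (- 2 * (\<alpha> + of_nat k))"
proof -
  have nz: "1 - \<rho> \<noteq> 0" using assms by auto
  have "(1 - \<rho>) powr (- 2 * \<alpha>) = (1 - \<rho>) powr (- 2 * (\<alpha> + of_nat k) + of_nat (2 * k))"
    by (simp add: algebra_simps)
  also have "\<dots> = (1 - \<rho>) powr (- 2 * (\<alpha> + of_nat k)) * (1 - \<rho>) ^ (2 * k)"
    using nz by (simp only: powr_add powr_nat' not_False_eq_True simp_thms)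
  also have "(1 - \<rho>) ^ (2 * k) = ((1 - \<rho>) ^ 2) ^ k"
    by (rule power_mult)
  finally show ?thesis
    using nz by (simp add: power_divide)
qed

text \<open>The duplication formula (2w)_(2k) = 4^k (w)_k (w + 1/2)_k, used for w = \<alpha>, where
  \<alpha> + 1/2 = A + B cancels a factor of the denominator, and for w = g, where (g + 1/2)_k
  belongs to \<open>Hahn_denom\<close>.\<close>

lemma pochhammer_Beta_eq_Hahn_denom:
  fixes A B C :: real and k :: nat
  assumes "A > 0" "B > 0" "C > 0"
  defines "\<alpha> \<equiv> complex_of_real (A + B - 1 / 2)" and "g \<equiv> complex_of_real (A + C)"
  shows "4 ^ k * pochhammer \<alpha> k * Beta (g + of_nat k) (g + of_nat k) =
    (Gamma g)\<^sup>2 * pochhammer (of_real (2 * A + 2 * B - 1)) k * pochhammer (of_real (real k + 2 * A + 2 * B - 1)) k * pochhammer g k /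
      (4 ^ k * of_real (Hahn_denom k (2 * A + 2 * C - 1)) * pochhammer (of_real (A + B)) k)"
proof -
  have g: "Re g > 0" "Re (2 * g) > 0" "Re (g + 1 / 2) > 0" using assms by (auto simp: g_def)
  have AB: "pochhammer (complex_of_real (A + B)) k \<noteq> 0"
    using assms by (intro pochhammer_Re_pos_nonzero) simp
  have nz: "pochhammer g k \<noteq> 0" "pochhammer (g + 1 / 2) k \<noteq> 0"
    by (intro pochhammer_Re_pos_nonzero g)+
  have Gam: "Gamma g \<noteq> 0" "Gamma (2 * g) \<noteq> 0"
    using Re_pos_not_nonpos_Int[OF g(1)] Re_pos_not_nonpos_Int[OF g(2)] by (simp_all add: Gamma_eq_zero_iff)
  have four: "of_nat (2 ^ (2 * k)) = (4 :: complex) ^ k"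
    by (simp add: power_mult)
  have "pochhammer (of_real (2 * A + 2 * B - 1)) k * pochhammer (of_real (real k + 2 * A + 2 * B - 1)) k =
      pochhammer (2 * \<alpha>) (2 * k)"
  proof -
    have "of_real (2 * A + 2 * B - 1) = 2 * \<alpha>" "of_real (real k + 2 * A + 2 * B - 1) = 2 * \<alpha> + of_nat k"
      by (simp_all add: \<alpha>_def)
    then show ?thesis by (simp only: mult_2[of k] pochhammer_product')
  qed
  also have "\<dots> = 4 ^ k * pochhammer \<alpha> k * pochhammer (\<alpha> + 1 / 2) k"
    unfolding pochhammer_double four ..
  also have "\<alpha> + 1 / 2 = of_real (A + B)" by (simp add: \<alpha>_def)
  finally have num: "pochhammer (of_real (2 * A + 2 * B - 1)) k * pochhammer (of_real (real k + 2 * A + 2 * B - 1)) k =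
      4 ^ k * pochhammer \<alpha> k * pochhammer (of_real (A + B)) k" .
  have "Hahn_denom k (2 * A + 2 * C - 1) = Gamma (2 * A + 2 * C) * pochhammer (A + C + 1 / 2) k"
    using Hahn_denom_eq[of "2 * A + 2 * C - 1" k] assms by (simp add: field_simps)
  then have "of_real (Hahn_denom k (2 * A + 2 * C - 1)) = Gamma (of_real (2 * A + 2 * C)) * pochhammer (of_real (A + C + 1 / 2) :: complex) k"
    by (simp only: of_real_mult Gamma_complex_of_real[symmetric] pochhammer_of_real)
  then have den: "of_real (Hahn_denom k (2 * A + 2 * C - 1)) = Gamma (2 * g) * pochhammer (g + 1 / 2) k"
    by (simp add: g_def)
  have "Beta (g + of_nat k) (g + of_nat k) = Gamma (g + of_nat k) ^ 2 / Gamma (2 * g + of_nat (2 * k))"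
  proof -
    have "g + of_nat k + (g + of_nat k) = 2 * g + of_nat (2 * k)" by simp
    then show ?thesis by (simp only: Beta_def power2_eq_square)
  qed
  also have "Gamma (g + of_nat k) = Gamma g * pochhammer g k"
    using Re_pos_not_nonpos_Int[OF g(1)] Gam by (simp add: pochhammer_Gamma)
  also have "Gamma (2 * g + of_nat (2 * k)) = Gamma (2 * g) * pochhammer (2 * g) (2 * k)"
    using Re_pos_not_nonpos_Int[OF g(2)] Gam by (simp add: pochhammer_Gamma)
  also have "pochhammer (2 * g) (2 * k) = 4 ^ k * pochhammer g k * pochhammer (g + 1 / 2) k"
    unfolding pochhammer_double four ..
  finally have bet: "Beta (g + of_nat k) (g + of_nat k) =
     (Gamma g * pochhammer g k)\<^sup>2 / (Gamma (2 * g) * (4 ^ k * pochhammer g k * pochhammer (g + 1 / 2) k))" .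
  have "(Gamma g)\<^sup>2 * pochhammer (of_real (2 * A + 2 * B - 1)) k * pochhammer (of_real (real k + 2 * A + 2 * B - 1)) k * pochhammer g k /
      (4 ^ k * of_real (Hahn_denom k (2 * A + 2 * C - 1)) * pochhammer (of_real (A + B)) k) =
    (Gamma g)\<^sup>2 * (4 ^ k * pochhammer \<alpha> k * pochhammer (of_real (A + B)) k) * pochhammer g k /
      (4 ^ k * (Gamma (2 * g) * pochhammer (g + 1 / 2) k) * pochhammer (of_real (A + B)) k)"
    unfolding den num[symmetric] by (simp only: mult_ac)
  also have "\<dots> = 4 ^ k * pochhammer \<alpha> k * ((Gamma g * pochhammer g k)\<^sup>2 / (Gamma (2 * g) * (4 ^ k * pochhammer g k * pochhammer (g + 1 / 2) k)))"
    using AB nz Gam by (simp add: power2_eq_square)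
  finally show ?thesis unfolding bet by simp
qed

lemma has_bochner_integral_gegen_fourier:
  fixes A B C :: real and \<rho> :: complex
  assumes pos: "A > 0" "C > 0" and \<rho>: "norm \<rho> < 1"
  defines "\<alpha> \<equiv> complex_of_real (A + B - 1 / 2)" and "g \<equiv> complex_of_real (A + C)"
    and "z \<equiv> - (4 * \<rho> / (1 - \<rho>) ^ 2)"
  shows "has_bochner_integral lborel
    (\<lambda>x. euler_integral (of_real A + \<i> * of_real x) (of_real A - \<i> * of_real x) (- \<alpha>) z *
      (Beta (of_real C + \<i> * of_real x) (of_real C - \<i> * of_real x) *
       (\<Sum>j\<le>k. gegen_coeff k g j * pochhammer (of_real C - \<i> * of_real x) j / pochhammer (of_real (2 * C)) j)))
    (2 * pi * ((- z) ^ k * pochhammer \<alpha> k / pochhammer g k * euler_integral (g + of_nat k) (g + of_nat k) (- (\<alpha> + of_nat k)) z))"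
proof -
  have z: "z \<in> cut_plane" unfolding z_def by (rule koebe_in_cut_plane[OF \<rho>])
  have g: "Re g > 0" using pos by (simp add: g_def)
  have psi: "(\<integral>u. beta_kernel (of_real C - \<i> * of_real x) (of_real C + \<i> * of_real x) u * poly (gegen_poly k g) (of_real (logistic u)) \<partial>lborel) =
    Beta (of_real C + \<i> * of_real x) (of_real C - \<i> * of_real x) *
       (\<Sum>j\<le>k. gegen_coeff k g j * pochhammer (of_real C - \<i> * of_real x) j / pochhammer (of_real (2 * C)) j)" for x
  proof -
    have "Re (of_real C - \<i> * of_real x) > 0" "Re (of_real C + \<i> * of_real x) > 0" using pos by auto
    from integral_beta_kernel_gegen_poly[OF this, of k g] show ?thesis
      by (subst Beta_commute) simp
  qed
  have "has_bochner_integral lborel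
    (\<lambda>x. (\<integral>u. beta_kernel (of_real A + \<i> * of_real x) (of_real A - \<i> * of_real x) u * (1 - z * of_real (logistic u)) powr (- \<alpha>) \<partial>lborel) *
         (\<integral>u. beta_kernel (of_real C - \<i> * of_real x) (of_real C + \<i> * of_real x) u * poly (gegen_poly k g) (of_real (logistic u)) \<partial>lborel))
    (2 * pi * (\<integral>u. beta_kernel (of_real (A + C)) (of_real (A + C)) u *
       (poly (gegen_poly k g) (of_real (logistic u)) * (1 - z * of_real (logistic u)) powr (- \<alpha>)) \<partial>lborel))"
    by (rule has_bochner_integral_beta_kernel_fourier
          [OF pos, of "\<lambda>t. (1 - z * of_real t) powr (- \<alpha>)" "\<lambda>t. poly (gegen_poly k g) (of_real t)"])
       (intro continuous_intros continuous_on_one_minus_mult_powr' z)+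
  then show ?thesis
    unfolding psi g_def[symmetric] gegen_integral_def[symmetric] euler_integral_def[symmetric] gegen_integral_eq[OF g z] .
qed

theorem corollary6p7:
  fixes k :: nat and \<rho> a b c :: complex
  assumes "norm \<rho> < 1"
    and "Re a > 0" and "Re b > 0" and "Re c > 0"
    and "Im a = Im b" and "Im b = Im c"
  shows "has_bochner_integral lborel
     (\<lambda>x::real.
        (1 - \<rho>) powr complex_of_real (1 - 2 * Re a - 2 * Re b) *
        hypergeo_cont
          [complex_of_real (Re a + Re b - 1 / 2), complex_of_real (Re a + Re b),
           a + \<i> * complex_of_real x]
          [complex_of_real (2 * Re a), a + cnj b]
          (- (4 * \<rho> / (1 - \<rho>) ^ 2)) *
        complex_of_real
          ((norm (Gamma (a + \<i> * complex_of_real x) * Gamma (c + \<i> * complex_of_real x))) ^ 2) *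
        continuous_Hahn k a c (complex_of_real x))
     (2 * complex_of_real pi * (- \<i> * \<rho>) ^ k *
        Gamma (complex_of_real (2 * Re a)) * Gamma (complex_of_real (2 * Re c)) *
        (Gamma (a + cnj c)) ^ 2 *
        pochhammer (complex_of_real (2 * Re a + 2 * Re b - 1)) k *
        pochhammer (complex_of_real (real k + 2 * Re a + 2 * Re b - 1)) k *
        pochhammer (a + cnj c) k *
        pochhammer (complex_of_real (2 * Re c)) k /
        (4 ^ k * fact k *
         complex_of_real (Hahn_denom k (2 * Re a + 2 * Re c - 1)) *
         pochhammer (complex_of_real (Re a + Re b)) k) *
      hypergeo_series
        [complex_of_real (Re a + Re b + real k - 1 / 2), complex_of_real (Re b - Re c)]
        [complex_of_real (Re a + Re c + real k + 1 / 2)]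
        (\<rho> ^ 2))"
    (is "has_bochner_integral lborel ?f ?I")
proof -
  define A B C s where "A = Re a" and "B = Re b" and "C = Re c" and "s = Im a"
  note defs = A_def B_def C_def s_def
  define \<alpha> g where "\<alpha> = complex_of_real (A + B - 1 / 2)" and "g = complex_of_real (A + C)"
  define z where "z = - (4 * \<rho> / (1 - \<rho>) ^ 2)"
  define H where "H = hypergeo_series [complex_of_real (A + B + real k - 1 / 2), complex_of_real (B - C)]
    [complex_of_real (A + C + real k + 1 / 2)] (\<rho> ^ 2)"
  \<comment> \<open>The two Gamma values convert the Beta factors into the squared moduli of Gamma;
    the rest is the prefactor from \<open>continuous_Hahn_swap\<close>.\<close>
  define K0 where "K0 = Gamma (complex_of_real (2 * A)) * Gamma (complex_of_real (2 * C)) *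
    ((- \<i>) ^ k * pochhammer (of_real (2 * C)) k * pochhammer g k / fact k)"
  define K where "K = (1 - \<rho>) powr (- 2 * \<alpha>) * K0"
  have pos: "A > 0" "B > 0" "C > 0" using assms by (simp_all add: defs)
  have z: "z \<in> cut_plane" unfolding z_def using assms by (intro koebe_in_cut_plane)
  have ac: "a + cnj c = g" and ab: "a + cnj b = of_real (A + B)"
    using assms by (simp_all add: g_def defs complex_eq_iff)
  have g: "Re (g + of_nat k) > 0" using pos by (simp add: g_def)
  have nz: "pochhammer g k \<noteq> 0" using pos by (intro pochhammer_Re_pos_nonzero) (simp add: g_def)
  define \<Phi> where "\<Phi> = (\<lambda>x. euler_integral (of_real A + \<i> * of_real x) (of_real A - \<i> * of_real x) (- \<alpha>) z)"
  define \<Psi> where "\<Psi> = (\<lambda>x. Beta (of_real C + \<i> * of_real x) (of_real C - \<i> * of_real x) *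
       (\<Sum>j\<le>k. gegen_coeff k g j * pochhammer (of_real C - \<i> * of_real x) j / pochhammer (of_real (2 * C)) j))"
  have "has_bochner_integral lborel (\<lambda>x. \<Phi> x * \<Psi> x)
    (2 * pi * ((- z) ^ k * pochhammer \<alpha> k / pochhammer g k * euler_integral (g + of_nat k) (g + of_nat k) (- (\<alpha> + of_nat k)) z))"
    unfolding \<Phi>_def \<Psi>_def \<alpha>_def g_def z_def using pos assms by (intro has_bochner_integral_gegen_fourier)
  \<comment> \<open>Translation by the common imaginary part: a + ix = A + i(s + x), and likewise
    for c.\<close>
  then have "has_bochner_integral lborel (\<lambda>x. \<Phi> (s + x) * \<Psi> (s + x))
    (2 * pi * ((- z) ^ k * pochhammer \<alpha> k / pochhammer g k * euler_integral (g + of_nat k) (g + of_nat k) (- (\<alpha> + of_nat k)) z))"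
    by (subst (asm) lborel_has_bochner_integral_real_affine_iff[of 1 _ _ s]) auto
  then have "has_bochner_integral lborel (\<lambda>x. K * (\<Phi> (s + x) * \<Psi> (s + x)))
    (K * (2 * pi * ((- z) ^ k * pochhammer \<alpha> k / pochhammer g k * euler_integral (g + of_nat k) (g + of_nat k) (- (\<alpha> + of_nat k)) z)))"
    by (rule has_bochner_integral_mult_right)
  moreover have "K * (\<Phi> (s + x) * \<Psi> (s + x)) = ?f x" for x
  proof -
    have ax: "a + \<i> * of_real x = of_real A + \<i> * of_real (s + x)"
      and cx: "c + \<i> * of_real x = of_real C + \<i> * of_real (s + x)"
      using assms by (simp_all add: defs complex_eq_iff)
    have ReA: "Re (of_real A + \<i> * of_real (s + x)) > 0" "Re (of_real A - \<i> * of_real (s + x)) > 0"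
      using pos by simp_all
    have "of_real A + \<i> * of_real (s + x) + (of_real A - \<i> * of_real (s + x)) = complex_of_real (2 * A)" by simp
    with Beta_mult_hypergeo_cont[OF ReA _ z, of "of_real (A + B)" \<alpha>] pos
    have Phi: "\<Phi> (s + x) = Beta (of_real A + \<i> * of_real (s + x)) (of_real A - \<i> * of_real (s + x)) *
       hypergeo_cont [\<alpha>, of_real (A + B), of_real A + \<i> * of_real (s + x)] [of_real (2 * A), of_real (A + B)] z"
      by (simp add: \<Phi>_def)
    have "continuous_Hahn k a c (of_real x) = (- \<i>) ^ k * pochhammer (of_real (2 * C)) k * pochhammer g k / fact k *
      (\<Sum>j\<le>k. gegen_coeff k g j * pochhammer (of_real C - \<i> * of_real (s + x)) j / pochhammer (of_real (2 * C)) j)"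
      using continuous_Hahn_swap[of a c k x] assms by (simp add: defs g_def add.commute)
    then have "?f x = (1 - \<rho>) powr (- 2 * \<alpha>) *
       hypergeo_cont [\<alpha>, of_real (A + B), of_real A + \<i> * of_real (s + x)] [of_real (2 * A), of_real (A + B)] z *
       (of_real ((norm (Gamma (of_real A + \<i> * of_real (s + x))))\<^sup>2) * of_real ((norm (Gamma (of_real C + \<i> * of_real (s + x))))\<^sup>2)) *
       ((- \<i>) ^ k * pochhammer (of_real (2 * C)) k * pochhammer g k / fact k *
      (\<Sum>j\<le>k. gegen_coeff k g j * pochhammer (of_real C - \<i> * of_real (s + x)) j / pochhammer (of_real (2 * C)) j))"
      unfolding ax cx ab z_def[symmetric] norm_mult power_mult_distrib of_real_mult
      by (simp add: \<alpha>_def defs algebra_simps)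
    then show ?thesis
      unfolding Phi \<Psi>_def K_def K0_def Beta_conjugate[OF pos(1), symmetric] Beta_conjugate[OF pos(3), symmetric]
      by (simp only: mult_ac)
  qed
  moreover have "K * (2 * pi * ((- z) ^ k * pochhammer \<alpha> k / pochhammer g k * euler_integral (g + of_nat k) (g + of_nat k) (- (\<alpha> + of_nat k)) z)) = ?I"
  proof -
    \<comment> \<open>The shifts by k cancel in the second parameter, and \<alpha> - g + 1/2 = B -
      C.\<close>
    have "[\<alpha> + of_nat k, \<alpha> + of_nat k - (g + of_nat k) + 1 / 2] = [complex_of_real (A + B + real k - 1 / 2), complex_of_real (B - C)]"
      "[g + of_nat k + 1 / 2] = [complex_of_real (A + C + real k + 1 / 2)]"
      by (simp_all add: \<alpha>_def g_def)
    with euler_integral_koebe[OF g assms(1), of "\<alpha> + of_nat k"]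
    have E: "(1 - \<rho>) powr (- 2 * (\<alpha> + of_nat k)) * euler_integral (g + of_nat k) (g + of_nat k) (- (\<alpha> + of_nat k)) z =
       Beta (g + of_nat k) (g + of_nat k) * H"
      unfolding H_def z_def by (simp only:)
    have "K * (2 * pi * ((- z) ^ k * pochhammer \<alpha> k / pochhammer g k * euler_integral (g + of_nat k) (g + of_nat k) (- (\<alpha> + of_nat k)) z)) =
       2 * pi * K0 * pochhammer \<alpha> k / pochhammer g k *
        (((1 - \<rho>) powr (- 2 * \<alpha>) * (4 * \<rho> / (1 - \<rho>) ^ 2) ^ k) * euler_integral (g + of_nat k) (g + of_nat k) (- (\<alpha> + of_nat k)) z)"
      by (simp add: K_def z_def mult_ac)
    also have "\<dots> = 2 * pi * K0 * pochhammer \<alpha> k / pochhammer g k * (4 * \<rho>) ^ k *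
        ((1 - \<rho>) powr (- 2 * (\<alpha> + of_nat k)) * euler_integral (g + of_nat k) (g + of_nat k) (- (\<alpha> + of_nat k)) z)"
      unfolding koebe_power_mult_powr[OF assms(1)] by (simp only: mult_ac)
    also have "\<dots> = 2 * pi * \<rho> ^ k * (K0 / pochhammer g k) * (4 ^ k * pochhammer \<alpha> k * Beta (g + of_nat k) (g + of_nat k)) * H"
      unfolding E by (simp add: power_mult_distrib mult_ac)
    also have "K0 / pochhammer g k = Gamma (complex_of_real (2 * A)) * Gamma (complex_of_real (2 * C)) *
       ((- \<i>) ^ k * pochhammer (of_real (2 * C)) k / fact k)"
      using nz by (simp add: K0_def)
    also have "4 ^ k * pochhammer \<alpha> k * Beta (g + of_nat k) (g + of_nat k) =
       (Gamma g)\<^sup>2 * pochhammer (of_real (2 * A + 2 * B - 1)) k * pochhammer (of_real (real k + 2 * A + 2 * B - 1)) k * pochhammer g k /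
      (4 ^ k * of_real (Hahn_denom k (2 * A + 2 * C - 1)) * pochhammer (of_real (A + B)) k)"
      unfolding \<alpha>_def g_def by (rule pochhammer_Beta_eq_Hahn_denom[OF pos])
    finally show ?thesis
      unfolding ac H_def defs power_mult_distrib of_real_mult[of 2 pi] of_real_numeral
      by (simp add: mult_ac del: of_real_add of_real_mult of_real_diff)
  qed
  ultimately show ?thesis by (simp only:)
qed

end
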